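(* Let $p$ be a prime, and let $f(x)\in\mathbb Q_p[x]$ be a polynomial with $\deg f=l\geq0$ and $f(a)\in\mathbb Z_p$ for all $a\in\mathbb Z$. Let $\alpha\in\mathbb N$ and $r\in\mathbb Z$. Then, for any integer $n\geq p^{\alpha-1}$, we have $$\mathrm{ord}_p\left(\sum_{k=0}^n\binom nk(-1)^k(k-r,p^{\alpha})\,f\left(\left\lfloor\frac{k-r}{p^{\alpha}}\right\rfloor\right)\right)\geq\left\lfloor\frac{n-p^{\alpha-1}-l(\delta_{\alpha,0}+\delta_{\alpha,1})}{\varphi(p^{\alpha})}\right\rfloor-(l-1)\alpha-1,$$ where $(k-r,p^{\alpha})$ is the greatest common divisor of $k-r$ and $p^{\alpha}$.
   Context: $\mathbb N=\{0,1,2,\ldots\}$. $\mathbb Q_p$ is the field of $p$-adic numbers and $\mathbb Z_p$ the ring of $p$-adic integers. $\mathrm{ord}_p$ denotes the $p$-adic order on $\mathbb Q_p$, with $\mathrm{ord}_p(0)=+\infty$. $\varphi$ is Euler's totient function, with $\varphi(p^0)=1$. When $\alpha=0$, $p^{\alpha-1}$ denotes the rational number $1/p$. $\lfloor\cdot\rfloor$ is the floor function. $\delta_{m,n}$ is $1$ if $m=n$ and $0$ otherwise. *)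

theory Defs
  imports
    "HOL-Number_Theory.Number_Theory"
    "HOL-Library.Extended_Real"
    "Berlekamp_Zassenhaus.Finite_Field"
begin

section \<open>The \<open>p\<close>-adic order on the rationals\<close>

definition rat_ord :: "nat \<Rightarrow> rat \<Rightarrow> ereal" where
  "rat_ord p x =
    (if x = 0 then \<infinity>
     else ereal (real (multiplicity (int p) (fst (quotient_of x)))
               - real (multiplicity (int p) (snd (quotient_of x)))))"

lemma rat_ord_0 [simp]: "rat_ord p 0 = \<infinity>"
  by (simp add: rat_ord_def)

lemma rat_ord_eq_PInf_iff [simp]: "rat_ord p x = \<infinity> \<longleftrightarrow> x = 0"
  by (simp add: rat_ord_def)

lemma rat_ord_neq_MInf [simp]: "rat_ord p x \<noteq> - \<infinity>"
  by (simp add: rat_ord_def)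

lemma rat_ord_finite: "x \<noteq> 0 \<Longrightarrow> \<exists>v. rat_ord p x = ereal v"
  by (simp add: rat_ord_def)

lemma rat_ord_Fract:
  assumes p: "prime p" and a: "a \<noteq> 0" and b: "b \<noteq> 0"
  shows "rat_ord p (Rat.Fract a b) = ereal (real (multiplicity (int p) a) - real (multiplicity (int p) b))"
proof -
  obtain c d where q: "quotient_of (Rat.Fract a b) = (c, d)" by (cases "quotient_of (Rat.Fract a b)")
  have d: "d > 0" using q by (rule quotient_of_denom_pos)
  have eq: "Rat.Fract a b = Rat.Fract c d"
    using quotient_of_div[OF q] by (simp add: Fract_of_int_quotient)
  have cross: "a * d = c * b" using eq d b by (simp add: eq_rat)
  have c: "c \<noteq> 0" using cross a d by auto
  have pe: "prime_elem (int p)" using p by simp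
  have "multiplicity (int p) (a * d) = multiplicity (int p) (c * b)" using cross by simp
  hence "multiplicity (int p) a + multiplicity (int p) d
       = multiplicity (int p) c + multiplicity (int p) b"
    using prime_elem_multiplicity_mult_distrib[OF pe] a b c d by simp
  moreover have "Rat.Fract a b \<noteq> 0" using a b by (simp add: Zero_rat_def eq_rat)
  ultimately show ?thesis by (simp add: rat_ord_def q flip: of_nat_add)
qed

lemma rat_ord_of_int:
  assumes "prime p" "a \<noteq> 0"
  shows "rat_ord p (of_int a) = ereal (real (multiplicity (int p) a))"
  using rat_ord_Fract[OF assms, of 1] by (simp add: Fract_of_int_eq)

lemma rat_ord_of_int_ge_iff:
  assumes p: "prime p"
  shows "ereal (real m) \<le> rat_ord p (of_int a) \<longleftrightarrow> int p ^ m dvd a"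
proof (cases "a = 0")
  case False
  have "\<not> is_unit (int p)" using prime_gt_1_nat[OF p] by simp
  thus ?thesis using False p by (simp add: rat_ord_of_int power_dvd_iff_le_multiplicity)
qed simp

lemma rat_ord_1 [simp]: "prime p \<Longrightarrow> rat_ord p 1 = 0"
  using rat_ord_of_int[of p 1] by (simp add: zero_ereal_def)

lemma rat_ord_mult:
  assumes p: "prime p"
  shows "rat_ord p (x * y) = rat_ord p x + rat_ord p y"
proof (cases "x = 0 \<or> y = 0")
  case True
  thus ?thesis using rat_ord_neq_MInf by auto
next
  case False
  obtain a b where x: "x = Rat.Fract a b" "b > 0" by (cases x) auto
  obtain c d where y: "y = Rat.Fract c d" "d > 0" by (cases y) auto
  have nz: "a \<noteq> 0" "c \<noteq> 0" using False x y by (auto simp: Zero_rat_def eq_rat)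
  have pe: "prime_elem (int p)" using p by simp
  show ?thesis
    using nz x(2) y(2)
    by (simp add: x(1) y(1) rat_ord_Fract[OF p] prime_elem_multiplicity_mult_distrib[OF pe])
qed

lemma rat_ord_minus [simp]: "rat_ord p (- x) = rat_ord p x"
proof -
  obtain a b where q: "quotient_of x = (a, b)" by (cases "quotient_of x")
  have "quotient_of (- x) = (- a, b)" by (simp add: rat_uminus_code q)
  moreover have "multiplicity (int p) (- a) = multiplicity (int p) a" by (rule multiplicity_cong) simp
  ultimately show ?thesis using q by (simp add: rat_ord_def)
qed

lemma rat_ord_diff_commute: "rat_ord p (x - y) = rat_ord p (y - x)"
  using rat_ord_minus[of p "x - y"] by simp

lemma rat_ord_add:
  assumes p: "prime p"
  shows "min (rat_ord p x) (rat_ord p y) \<le> rat_ord p (x + y)"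
proof (cases "x = 0 \<or> y = 0 \<or> x + y = 0")
  case True
  thus ?thesis by auto
next
  case False
  obtain a b where x: "x = Rat.Fract a b" "b > 0" by (cases x) auto
  obtain c d where y: "y = Rat.Fract c d" "d > 0" by (cases y) auto
  have nz: "a \<noteq> 0" "c \<noteq> 0" using False x y by (auto simp: Zero_rat_def eq_rat)
  have pe: "prime_elem (int p)" using p by simp
  have nu: "\<not> is_unit (int p)" using prime_gt_1_nat[OF p] by simp
  have s: "x + y = Rat.Fract (a * d + c * b) (b * d)" using x y by simp
  have snz: "a * d + c * b \<noteq> 0" using False s x y by (auto simp: rat_number_collapse)
  let ?m = "multiplicity (int p)"
  let ?k = "min (?m (a * d)) (?m (c * b))"
  have "int p ^ ?k dvd a * d" "int p ^ ?k dvd c * b"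
    by (simp_all add: multiplicity_dvd')
  hence "int p ^ ?k dvd a * d + c * b" by (rule dvd_add)
  hence "?k \<le> ?m (a * d + c * b)"
    using snz nu by (simp add: power_dvd_iff_le_multiplicity)
  hence "min (?m a + ?m d) (?m c + ?m b) \<le> ?m (a * d + c * b)"
    using nz x(2) y(2) prime_elem_multiplicity_mult_distrib[OF pe] by simp
  hence "min (real (?m a) + real (?m d)) (real (?m c) + real (?m b)) \<le> real (?m (a * d + c * b))"
    by (simp add: min_le_iff_disj flip: of_nat_add)
  moreover have "rat_ord p (x + y) = ereal (real (?m (a * d + c * b)) - (real (?m b) + real (?m d)))"
    unfolding s using snz x(2) y(2)
    by (simp add: rat_ord_Fract[OF p] prime_elem_multiplicity_mult_distrib[OF pe])
  moreover have "rat_ord p x = ereal (real (?m a) - real (?m b))"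
      "rat_ord p y = ereal (real (?m c) - real (?m d))"
    using nz x y by (simp_all add: rat_ord_Fract[OF p])
  ultimately show ?thesis by (auto simp: min_le_iff_disj)
qed

lemma rat_ord_add_ge:
  assumes "prime p" "M \<le> rat_ord p x" "M \<le> rat_ord p y"
  shows "M \<le> rat_ord p (x + y)"
  using rat_ord_add[OF assms(1), of x y] assms(2,3) by (meson min.boundedI order_trans)

lemma rat_ord_diff_ge:
  assumes "prime p" "M \<le> rat_ord p x" "M \<le> rat_ord p y"
  shows "M \<le> rat_ord p (x - y)"
  using rat_ord_add_ge[OF assms(1,2), of "- y"] assms(3) by simp

lemma rat_ord_add_eq:
  assumes p: "prime p" and less: "rat_ord p x < rat_ord p y"
  shows "rat_ord p (x + y) = rat_ord p x"
proof (rule antisym)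
  show "rat_ord p x \<le> rat_ord p (x + y)"
    using rat_ord_add[OF p, of x y] less by (simp add: min_def split: if_splits)
  show "rat_ord p (x + y) \<le> rat_ord p x"
    using rat_ord_add[OF p, of "x + y" "- y"] less by (auto simp: min_le_iff_disj)
qed

lemma rat_ord_inverse:
  assumes p: "prime p" and x: "x \<noteq> 0"
  shows "rat_ord p (inverse x) = - rat_ord p x"
proof -
  have "rat_ord p x + rat_ord p (inverse x) = 0"
    using rat_ord_mult[OF p, of x "inverse x"] x p by simp
  thus ?thesis using rat_ord_finite[OF x, of p] by (cases "rat_ord p (inverse x)") auto
qed


section \<open>Cauchy and null sequences for the \<open>p\<close>-adic topology\<close>

definition padic_cauchy :: "nat \<Rightarrow> (nat \<Rightarrow> rat) \<Rightarrow> bool" where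
  "padic_cauchy p X \<longleftrightarrow> (\<forall>M::real. \<exists>N. \<forall>m\<ge>N. \<forall>n\<ge>N. ereal M \<le> rat_ord p (X m - X n))"

definition padic_null :: "nat \<Rightarrow> (nat \<Rightarrow> rat) \<Rightarrow> bool" where
  "padic_null p X \<longleftrightarrow> (\<forall>M::real. \<exists>N. \<forall>n\<ge>N. ereal M \<le> rat_ord p (X n))"

lemma padic_cauchy_const [simp]: "padic_cauchy p (\<lambda>n. x)"
  by (simp add: padic_cauchy_def)

lemma padic_null_zero [simp]: "padic_null p (\<lambda>n. 0)"
  by (simp add: padic_null_def)

lemma padic_null_const [simp]: "padic_null p (\<lambda>n. x) \<longleftrightarrow> x = 0"
proof
  assume "padic_null p (\<lambda>n. x)"
  hence *: "ereal M \<le> rat_ord p x" for M by (auto simp: padic_null_def)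
  show "x = 0"
  proof (rule ccontr)
    assume "x \<noteq> 0"
    then obtain v where "rat_ord p x = ereal v" using rat_ord_finite by blast
    with *[of "v + 1"] show False by simp
  qed
qed simp

lemma padic_null_minus [simp]: "padic_null p (\<lambda>n. - X n) \<longleftrightarrow> padic_null p X"
  by (simp add: padic_null_def)

lemma padic_null_swap: "padic_null p (\<lambda>n. X n - Y n) \<longleftrightarrow> padic_null p (\<lambda>n. Y n - X n)"
  by (simp add: padic_null_def rat_ord_diff_commute)

lemma padic_null_add:
  assumes p: "prime p" and X: "padic_null p X" and Y: "padic_null p Y"
  shows "padic_null p (\<lambda>n. X n + Y n)"
  unfolding padic_null_def
proof
  fix M
  obtain N1 where "\<forall>n\<ge>N1. ereal M \<le> rat_ord p (X n)" using X by (auto simp: padic_null_def)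
  moreover obtain N2 where "\<forall>n\<ge>N2. ereal M \<le> rat_ord p (Y n)" using Y by (auto simp: padic_null_def)
  ultimately show "\<exists>N. \<forall>n\<ge>N. ereal M \<le> rat_ord p (X n + Y n)"
    using rat_ord_add_ge[OF p] by (intro exI[of _ "max N1 N2"]) simp
qed

lemma padic_null_diff:
  assumes p: "prime p" and X: "padic_null p X" and Y: "padic_null p Y"
  shows "padic_null p (\<lambda>n. X n - Y n)"
  using padic_null_add[OF p X, of "\<lambda>n. - Y n"] Y by simp

lemma padic_cauchy_minus [simp]: "padic_cauchy p (\<lambda>n. - X n) \<longleftrightarrow> padic_cauchy p X"
proof -
  have "- X m - - X n = - (X m - X n)" for m n by simp
  thus ?thesis unfolding padic_cauchy_def by (simp only: rat_ord_minus)
qed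

lemma padic_cauchy_add:
  assumes p: "prime p" and X: "padic_cauchy p X" and Y: "padic_cauchy p Y"
  shows "padic_cauchy p (\<lambda>n. X n + Y n)"
  unfolding padic_cauchy_def
proof
  fix M
  obtain N1 where 1: "\<forall>m\<ge>N1. \<forall>n\<ge>N1. ereal M \<le> rat_ord p (X m - X n)"
    using X unfolding padic_cauchy_def by meson
  obtain N2 where 2: "\<forall>m\<ge>N2. \<forall>n\<ge>N2. ereal M \<le> rat_ord p (Y m - Y n)"
    using Y unfolding padic_cauchy_def by meson
  have "ereal M \<le> rat_ord p ((X m - X n) + (Y m - Y n))" if "m \<ge> max N1 N2" "n \<ge> max N1 N2" for m n
    using 1 2 that by (intro rat_ord_add_ge[OF p]) auto
  thus "\<exists>N. \<forall>m\<ge>N. \<forall>n\<ge>N. ereal M \<le> rat_ord p (X m + Y m - (X n + Y n))"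
    by (intro exI[of _ "max N1 N2"]) (simp add: add_diff_add)
qed

lemma padic_cauchy_bounded:
  assumes p: "prime p" and X: "padic_cauchy p X"
  shows "\<exists>B::real. \<forall>n. ereal B \<le> rat_ord p (X n)"
proof -
  have fin: "\<exists>b::real. ereal b \<le> rat_ord p x" for x
    using rat_ord_finite[of x p] by (cases "x = 0") (auto intro: exI[of _ 0])
  obtain N where N: "\<forall>m\<ge>N. \<forall>n\<ge>N. ereal 0 \<le> rat_ord p (X m - X n)"
    using X unfolding padic_cauchy_def by meson
  have "\<forall>n. \<exists>b::real. ereal b \<le> rat_ord p (X n)" using fin by blast
  then obtain b where b: "\<And>n. ereal (b n) \<le> rat_ord p (X n)" using choice[of "\<lambda>n b. ereal b \<le> rat_ord p (X n)"] by blast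
  define B where "B = Min (insert 0 (b ` {..N}))"
  have Bb: "B \<le> b n" if "n \<le> N" for n using that unfolding B_def by (intro Min_le) auto
  have B0: "B \<le> 0" unfolding B_def by (intro Min_le) auto
  have "ereal B \<le> rat_ord p (X n)" for n
  proof (cases "n \<le> N")
    case True
    thus ?thesis using Bb[OF True] b[of n] by (meson ereal_less_eq(3) order_trans)
  next
    case False
    have "ereal B \<le> rat_ord p (X n - X N)"
      using N False B0 by (meson ereal_less_eq(3) nat_le_linear order_trans order_refl)
    moreover have "ereal B \<le> rat_ord p (X N)"
      using Bb[of N] b[of N] by (meson ereal_less_eq(3) order_refl order_trans)
    ultimately have "ereal B \<le> rat_ord p ((X n - X N) + X N)" by (rule rat_ord_add_ge[OF p])
    thus ?thesis by simp
  qed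
  thus ?thesis by blast
qed

lemma padic_null_mult_bounded:
  assumes p: "prime p" and B: "\<And>n. ereal B \<le> rat_ord p (X n)" and Y: "padic_null p Y"
  shows "padic_null p (\<lambda>n. X n * Y n)"
  unfolding padic_null_def
proof
  fix M
  obtain N where N: "\<forall>n\<ge>N. ereal (M - B) \<le> rat_ord p (Y n)" using Y unfolding padic_null_def by meson
  have "ereal M \<le> rat_ord p (X n * Y n)" if "n \<ge> N" for n
  proof -
    have "ereal B + ereal (M - B) \<le> rat_ord p (X n) + rat_ord p (Y n)"
      using B N that by (intro add_mono) auto
    thus ?thesis by (simp add: rat_ord_mult[OF p])
  qed
  thus "\<exists>N. \<forall>n\<ge>N. ereal M \<le> rat_ord p (X n * Y n)" by blast
qed

lemma padic_cauchy_mult: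
  assumes p: "prime p" and X: "padic_cauchy p X" and Y: "padic_cauchy p Y"
  shows "padic_cauchy p (\<lambda>n. X n * Y n)"
  unfolding padic_cauchy_def
proof
  fix M
  obtain A where A: "\<And>n. ereal A \<le> rat_ord p (X n)" using padic_cauchy_bounded[OF p X] by blast
  obtain B where B: "\<And>n. ereal B \<le> rat_ord p (Y n)" using padic_cauchy_bounded[OF p Y] by blast
  obtain N1 where 1: "\<forall>m\<ge>N1. \<forall>n\<ge>N1. ereal (M - B) \<le> rat_ord p (X m - X n)"
    using X unfolding padic_cauchy_def by meson
  obtain N2 where 2: "\<forall>m\<ge>N2. \<forall>n\<ge>N2. ereal (M - A) \<le> rat_ord p (Y m - Y n)"
    using Y unfolding padic_cauchy_def by meson
  have "ereal M \<le> rat_ord p (X m * Y m - X n * Y n)" if mn: "m \<ge> max N1 N2" "n \<ge> max N1 N2" for m n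
  proof -
    have "ereal A + ereal (M - A) \<le> rat_ord p (X m) + rat_ord p (Y m - Y n)"
      using A 2 mn by (intro add_mono) auto
    hence "ereal M \<le> rat_ord p (X m * (Y m - Y n))" by (simp add: rat_ord_mult[OF p])
    moreover have "ereal (M - B) + ereal B \<le> rat_ord p (X m - X n) + rat_ord p (Y n)"
      using B 1 mn by (intro add_mono) auto
    hence "ereal M \<le> rat_ord p ((X m - X n) * Y n)" by (simp add: rat_ord_mult[OF p])
    ultimately show ?thesis unfolding mult_diff_mult by (rule rat_ord_add_ge[OF p])
  qed
  thus "\<exists>N. \<forall>m\<ge>N. \<forall>n\<ge>N. ereal M \<le> rat_ord p (X m * Y m - X n * Y n)" by blast
qed

lemma padic_not_null_eventually_const:
  assumes p: "prime p" and X: "padic_cauchy p X" and nz: "\<not> padic_null p X"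
  shows "\<exists>v::real. \<exists>N. \<forall>n\<ge>N. rat_ord p (X n) = ereal v"
proof -
  obtain M where M: "\<And>N. \<exists>n\<ge>N. rat_ord p (X n) < ereal M"
    using nz unfolding padic_null_def by (meson not_le)
  obtain N where N: "\<forall>m\<ge>N. \<forall>n\<ge>N. ereal M \<le> rat_ord p (X m - X n)"
    using X unfolding padic_cauchy_def by meson
  obtain k where k: "k \<ge> N" "rat_ord p (X k) < ereal M" using M by blast
  have "X k \<noteq> 0" using k(2) by auto
  then obtain v where v: "rat_ord p (X k) = ereal v" using rat_ord_finite by blast
  have "rat_ord p (X n) = ereal v" if "n \<ge> N" for n
  proof -
    have "rat_ord p (X k) < rat_ord p (X n - X k)"
      using N k that by (meson less_le_trans)
    from rat_ord_add_eq[OF p this] show ?thesis by (simp add: v)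
  qed
  thus ?thesis by blast
qed

lemma padic_inverse_null_diff:
  assumes p: "prime p"
    and x: "x \<noteq> 0" "rat_ord p x = ereal v" and y: "y \<noteq> 0" "rat_ord p y = ereal w"
    and M: "ereal (M + v + w) \<le> rat_ord p (x - y)"
  shows "ereal M \<le> rat_ord p (inverse x - inverse y)"
proof -
  have "inverse x - inverse y = - (inverse x * (x - y) * inverse y)"
    using x(1) y(1) by (simp add: inverse_diff_inverse)
  hence "rat_ord p (inverse x - inverse y) = ereal (- v) + rat_ord p (x - y) + ereal (- w)"
    using p x y by (simp add: rat_ord_mult rat_ord_inverse)
  moreover have "ereal (- v) + ereal (M + v + w) + ereal (- w)
      \<le> ereal (- v) + rat_ord p (x - y) + ereal (- w)"
    using M by (intro add_mono) auto
  ultimately show ?thesis by simp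
qed

lemma padic_cauchy_inverse:
  assumes p: "prime p" and X: "padic_cauchy p X" and nz: "\<not> padic_null p X"
  shows "padic_cauchy p (\<lambda>n. inverse (X n))"
  unfolding padic_cauchy_def
proof
  fix M
  obtain v N1 where v: "\<And>n. n \<ge> N1 \<Longrightarrow> rat_ord p (X n) = ereal v"
    using padic_not_null_eventually_const[OF assms] by blast
  obtain N2 where 2: "\<forall>m\<ge>N2. \<forall>n\<ge>N2. ereal (M + v + v) \<le> rat_ord p (X m - X n)"
    using X unfolding padic_cauchy_def by meson
  have nz: "X n \<noteq> 0" if "n \<ge> N1" for n using v[OF that] by auto
  have "ereal M \<le> rat_ord p (inverse (X m) - inverse (X n))" if "m \<ge> max N1 N2" "n \<ge> max N1 N2" for m n
    using that v 2 nz by (intro padic_inverse_null_diff[OF p, of _ v _ v]) auto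
  thus "\<exists>N. \<forall>m\<ge>N. \<forall>n\<ge>N. ereal M \<le> rat_ord p (inverse (X m) - inverse (X n))" by blast
qed

lemma padic_null_inverse_diff:
  assumes p: "prime p" and X: "padic_cauchy p X" "\<not> padic_null p X"
    and Y: "padic_cauchy p Y" "\<not> padic_null p Y" and XY: "padic_null p (\<lambda>n. X n - Y n)"
  shows "padic_null p (\<lambda>n. inverse (X n) - inverse (Y n))"
  unfolding padic_null_def
proof
  fix M
  obtain v N1 where v: "\<And>n. n \<ge> N1 \<Longrightarrow> rat_ord p (X n) = ereal v"
    using padic_not_null_eventually_const[OF p X] by blast
  obtain w N2 where w: "\<And>n. n \<ge> N2 \<Longrightarrow> rat_ord p (Y n) = ereal w"
    using padic_not_null_eventually_const[OF p Y] by blast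
  obtain N3 where 3: "\<forall>n\<ge>N3. ereal (M + v + w) \<le> rat_ord p (X n - Y n)"
    using XY unfolding padic_null_def by meson
  have nz: "X n \<noteq> 0" if "n \<ge> N1" for n using v[OF that] by auto
  have nz': "Y n \<noteq> 0" if "n \<ge> N2" for n using w[OF that] by auto
  have "ereal M \<le> rat_ord p (inverse (X n) - inverse (Y n))" if "n \<ge> max (max N1 N2) N3" for n
    using that v w 3 nz nz' by (intro padic_inverse_null_diff[OF p, of _ v _ w]) auto
  thus "\<exists>N. \<forall>n\<ge>N. ereal M \<le> rat_ord p (inverse (X n) - inverse (Y n))" by blast
qed

lemma padic_null_lim:
  assumes "padic_null p X"
  shows "(\<lambda>n. rat_ord p (X n)) \<longlonglongrightarrow> \<infinity>"
  unfolding tendsto_PInfty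
proof
  fix r :: real
  obtain N where N: "\<forall>n\<ge>N. ereal (r + 1) \<le> rat_ord p (X n)"
    using assms unfolding padic_null_def by meson
  have "ereal r < rat_ord p (X n)" if "n \<ge> N" for n
    using N that by (metis ereal_less_eq(3) less_add_one less_le_trans less_ereal.simps(1))
  thus "\<forall>\<^sub>F n in sequentially. ereal r < rat_ord p (X n)"
    unfolding eventually_sequentially by blast
qed

lemma padic_cauchy_convergent:
  assumes "prime p" "padic_cauchy p X"
  shows "(\<lambda>n. rat_ord p (X n)) \<longlonglongrightarrow> lim (\<lambda>n. rat_ord p (X n))"
proof (cases "padic_null p X")
  case True
  thus ?thesis using padic_null_lim limI by metis
next
  case False
  then obtain v N where "\<forall>n\<ge>N. rat_ord p (X n) = ereal v"
    using padic_not_null_eventually_const assms by blast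
  hence "(\<lambda>n. rat_ord p (X n)) \<longlonglongrightarrow> ereal v"
    by (intro tendsto_eventually) (auto simp: eventually_sequentially)
  thus ?thesis using limI by metis
qed


section \<open>The field of \<open>p\<close>-adic numbers\<close>

text \<open>
  The completion of the rationals with respect to the \<open>p\<close>-adic absolute value: Cauchy sequences
  modulo null sequences. The prime is carried by the type parameter: \<open>p = CARD('p)\<close>.
\<close>

definition padicrel :: "'p itself \<Rightarrow> (nat \<Rightarrow> rat) \<Rightarrow> (nat \<Rightarrow> rat) \<Rightarrow> bool" where
  "padicrel _ X Y \<longleftrightarrow> padic_cauchy CARD('p) X \<and> padic_cauchy CARD('p) Y \<and>
     padic_null CARD('p) (\<lambda>n. X n - Y n)"

lemma padicrel_sym: "padicrel TYPE('p) X Y \<Longrightarrow> padicrel TYPE('p) Y X"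
  unfolding padicrel_def using padic_null_swap[of "CARD('p)" X Y] by blast

lemma padicrel_trans:
  assumes "padicrel TYPE('p::prime_card) X Y" "padicrel TYPE('p) Y Z"
  shows "padicrel TYPE('p) X Z"
  using assms padic_null_add[OF prime_card[where 'a = 'p], of "\<lambda>n. X n - Y n" "\<lambda>n. Y n - Z n"]
  by (simp add: padicrel_def)

typedef ('p::prime_card) padic =
  "{C. \<exists>X. padicrel TYPE('p) X X \<and> C = Collect (padicrel TYPE('p) X)}"
  by (rule exI[of _ "Collect (padicrel TYPE('p) (\<lambda>n. 0))"], rule CollectI, rule exI[of _ "\<lambda>n. 0"])
    (simp add: padicrel_def)

definition Padic :: "(nat \<Rightarrow> rat) \<Rightarrow> 'p::prime_card padic" where
  "Padic X = Abs_padic (Collect (padicrel TYPE('p) X))"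

definition rep_padic :: "'p::prime_card padic \<Rightarrow> nat \<Rightarrow> rat" where
  "rep_padic x = (SOME X. X \<in> Rep_padic x)"

definition cr_padic :: "(nat \<Rightarrow> rat) \<Rightarrow> 'p::prime_card padic \<Rightarrow> bool" where
  "cr_padic X x \<longleftrightarrow> padicrel TYPE('p) X X \<and> Padic X = x"

lemma Padic_eq_iff:
  assumes "padicrel TYPE('p::prime_card) X X" "padicrel TYPE('p) Y Y"
  shows "(Padic X :: 'p padic) = Padic Y \<longleftrightarrow> padicrel TYPE('p) X Y"
proof -
  have "(Padic X :: 'p padic) = Padic Y
      \<longleftrightarrow> Collect (padicrel TYPE('p) X) = Collect (padicrel TYPE('p) Y)"
    unfolding Padic_def using assms by (intro Abs_padic_inject) auto
  also have "\<dots> \<longleftrightarrow> padicrel TYPE('p) X Y"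
  proof
    assume "Collect (padicrel TYPE('p) X) = Collect (padicrel TYPE('p) Y)"
    moreover have "Y \<in> Collect (padicrel TYPE('p) Y)" using assms(2) by simp
    ultimately have "Y \<in> Collect (padicrel TYPE('p) X)" by (simp only:)
    thus "padicrel TYPE('p) X Y" by simp
  next
    assume XY: "padicrel TYPE('p) X Y"
    show "Collect (padicrel TYPE('p) X) = Collect (padicrel TYPE('p) Y)"
    proof (rule Collect_cong, rule iffI)
      fix Z assume "padicrel TYPE('p) X Z"
      with padicrel_sym[OF XY] show "padicrel TYPE('p) Y Z" by (rule padicrel_trans)
    next
      fix Z assume "padicrel TYPE('p) Y Z"
      with XY show "padicrel TYPE('p) X Z" by (rule padicrel_trans)
    qed
  qed
  finally show ?thesis .
qed

lemma Padic_rep: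
  fixes x :: "'p::prime_card padic"
  shows "padicrel TYPE('p) (rep_padic x) (rep_padic x)" "Padic (rep_padic x) = x"
proof -
  have "\<exists>X. padicrel TYPE('p) X X \<and> Rep_padic x = Collect (padicrel TYPE('p) X)"
    using Rep_padic[of x] by (rule CollectD)
  then obtain X where X: "padicrel TYPE('p) X X" "Rep_padic x = Collect (padicrel TYPE('p) X)"
    by (elim exE conjE) (rule that)
  have "X \<in> Rep_padic x" using X by (simp only: mem_Collect_eq)
  hence "rep_padic x \<in> Rep_padic x" unfolding rep_padic_def by (rule someI[where P = "\<lambda>X. X \<in> Rep_padic x"])
  hence *: "padicrel TYPE('p) X (rep_padic x)" by (simp only: X(2) mem_Collect_eq)
  thus **: "padicrel TYPE('p) (rep_padic x) (rep_padic x)" by (simp add: padicrel_def)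
  have "Padic (rep_padic x) = (Padic X :: 'p padic)" using Padic_eq_iff[OF X(1) **] * by simp
  also have "\<dots> = x" unfolding Padic_def X(2)[symmetric] by (rule Rep_padic_inverse)
  finally show "Padic (rep_padic x) = x" .
qed

lemma Quotient_padic:
  "Quotient (padicrel TYPE('p)) Padic rep_padic (cr_padic :: _ \<Rightarrow> 'p::prime_card padic \<Rightarrow> bool)"
  unfolding Quotient_alt_def
proof (intro conjI allI impI)
  fix X Y
  show "padicrel TYPE('p) X Y = (cr_padic X (Padic X :: 'p padic) \<and>
      cr_padic Y (Padic Y :: 'p padic) \<and> (Padic X :: 'p padic) = Padic Y)"
  proof
    assume *: "padicrel TYPE('p) X Y"
    hence "padicrel TYPE('p) X X" "padicrel TYPE('p) Y Y" by (simp_all add: padicrel_def)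
    thus "cr_padic X (Padic X :: 'p padic) \<and> cr_padic Y (Padic Y :: 'p padic) \<and> (Padic X :: 'p padic) = Padic Y"
      using * by (simp add: cr_padic_def Padic_eq_iff)
    next
    assume "cr_padic X (Padic X :: 'p padic) \<and> cr_padic Y (Padic Y :: 'p padic) \<and> (Padic X :: 'p padic) = Padic Y"
    thus "padicrel TYPE('p) X Y" unfolding cr_padic_def using Padic_eq_iff by blast
  qed
next
  fix X and x :: "'p padic"
  assume "cr_padic X x"
  thus "Padic X = x" by (simp add: cr_padic_def)
next
  fix x :: "'p padic"
  show "cr_padic (rep_padic x) x" by (simp add: cr_padic_def Padic_rep)
qed

setup_lifting Quotient_padic

lemma padicrel_refl: "padicrel TYPE('p) X X \<longleftrightarrow> padic_cauchy CARD('p) X"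
  by (simp add: padicrel_def)

instantiation padic :: (prime_card) field
begin

lift_definition zero_padic :: "'a padic" is "\<lambda>n. 0"
  by (simp add: padicrel_def)

lift_definition one_padic :: "'a padic" is "\<lambda>n. 1"
  by (simp add: padicrel_def)

lift_definition plus_padic :: "'a padic \<Rightarrow> 'a padic \<Rightarrow> 'a padic" is "\<lambda>X Y n. X n + Y n"
  unfolding padicrel_def add_diff_add
  by (simp add: padic_cauchy_add padic_null_add prime_card)

lift_definition uminus_padic :: "'a padic \<Rightarrow> 'a padic" is "\<lambda>X n. - X n"
  unfolding padicrel_def minus_diff_minus padic_cauchy_minus padic_null_minus .

lift_definition times_padic :: "'a padic \<Rightarrow> 'a padic \<Rightarrow> 'a padic" is "\<lambda>X Y n. X n * Y n"
proof -
  fix X X' Y Y' :: "nat \<Rightarrow> rat"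
  let ?p = "CARD('a)"
  note p = prime_card[where 'a = 'a]
  assume "padicrel TYPE('a) X X'" "padicrel TYPE('a) Y Y'"
  hence X: "padic_cauchy ?p X" "padic_cauchy ?p X'" "padic_null ?p (\<lambda>n. X n - X' n)"
    and Y: "padic_cauchy ?p Y" "padic_cauchy ?p Y'" "padic_null ?p (\<lambda>n. Y n - Y' n)"
    by (simp_all add: padicrel_def)
  obtain A where A: "\<And>n. ereal A \<le> rat_ord ?p (X n)" using padic_cauchy_bounded[OF p X(1)] by blast
  obtain B where B: "\<And>n. ereal B \<le> rat_ord ?p (Y' n)" using padic_cauchy_bounded[OF p Y(2)] by blast
  have "padic_null ?p (\<lambda>n. X n * (Y n - Y' n) + Y' n * (X n - X' n))"
    by (intro padic_null_add[OF p] padic_null_mult_bounded[OF p A Y(3)]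
        padic_null_mult_bounded[OF p B X(3)])
  moreover have "X n * (Y n - Y' n) + Y' n * (X n - X' n) = X n * Y n - X' n * Y' n" for n
    by (simp add: algebra_simps)
  ultimately show "padicrel TYPE('a) (\<lambda>n. X n * Y n) (\<lambda>n. X' n * Y' n)"
    using X Y p by (simp add: padicrel_def padic_cauchy_mult)
qed

lift_definition inverse_padic :: "'a padic \<Rightarrow> 'a padic"
  is "\<lambda>X. if padic_null CARD('a) X then (\<lambda>n. 0) else (\<lambda>n. inverse (X n))"
proof -
  fix X Y :: "nat \<Rightarrow> rat"
  let ?p = "CARD('a)"
  note p = prime_card[where 'a = 'a]
  assume "padicrel TYPE('a) X Y"
  hence XY: "padic_cauchy ?p X" "padic_cauchy ?p Y" "padic_null ?p (\<lambda>n. X n - Y n)"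
    by (simp_all add: padicrel_def)
  have "padic_null ?p X \<longleftrightarrow> padic_null ?p Y"
    using padic_null_diff[OF p _ XY(3), of X] padic_null_add[OF p XY(3), of Y] by auto
  thus "padicrel TYPE('a) (if padic_null ?p X then (\<lambda>n. 0) else (\<lambda>n. inverse (X n)))
      (if padic_null ?p Y then (\<lambda>n. 0) else (\<lambda>n. inverse (Y n)))"
    using XY p by (simp add: padicrel_def padic_cauchy_inverse padic_null_inverse_diff)
qed

definition minus_padic :: "'a padic \<Rightarrow> 'a padic \<Rightarrow> 'a padic" where
  "minus_padic x y = x + - y"

definition divide_padic :: "'a padic \<Rightarrow> 'a padic \<Rightarrow> 'a padic" where
  "divide_padic x y = x * inverse y"

instance
proof
  fix a b c :: "'a padic"
  note p = prime_card[where 'a = 'a]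
  note [simp] = padic_cauchy_add[OF p] padic_cauchy_mult[OF p]
  show "a + b = b + a" by transfer (simp add: ac_simps padicrel_def)
  show "(a + b) + c = a + (b + c)" by transfer (simp add: ac_simps padicrel_def)
  show "0 + a = a" by transfer (simp add: padicrel_def)
  show "- a + a = 0" by transfer (simp add: padicrel_def)
  show "a - b = a + - b" by (rule minus_padic_def)
  show "(a * b) * c = a * (b * c)" by transfer (simp add: ac_simps padicrel_def)
  show "a * b = b * a" by transfer (simp add: ac_simps padicrel_def)
  show "1 * a = a" by transfer (simp add: padicrel_def)
  show "(a + b) * c = a * c + b * c" by transfer (simp add: distrib_right padicrel_def)
  show "(0::'a padic) \<noteq> 1" by transfer (simp add: padicrel_def)
  have "padic_null CARD('a) (\<lambda>n. inverse (X n) * X n - 1)"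
    if X: "padic_cauchy CARD('a) X" "\<not> padic_null CARD('a) X" for X
  proof -
    obtain v N where v: "\<forall>n\<ge>N. rat_ord CARD('a) (X n) = ereal v"
      using padic_not_null_eventually_const[OF p X] by blast
    have "inverse (X n) * X n - 1 = 0" if "n \<ge> N" for n
    proof -
      have "X n \<noteq> 0" using v that by auto
      thus ?thesis by simp
    qed
    thus ?thesis unfolding padic_null_def by (intro allI exI[of _ N]) simp
  qed
  thus "a \<noteq> 0 \<Longrightarrow> inverse a * a = 1"
    by transfer (auto simp: padicrel_def padic_cauchy_inverse[OF p])
  show "a div b = a * inverse b" by (rule divide_padic_def)
  show "inverse (0::'a padic) = 0" by transfer (simp add: padicrel_def)
qed

end

text \<open>The continuous extension of the \<open>p\<close>-adic order from the rationals.\<close>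

lift_definition padic_ord :: "'p::prime_card padic \<Rightarrow> ereal"
  is "\<lambda>X. lim (\<lambda>n. rat_ord CARD('p) (X n))"
proof -
  fix X Y :: "nat \<Rightarrow> rat"
  let ?p = "CARD('p)"
  note p = prime_card[where 'a = 'p]
  assume "padicrel TYPE('p) X Y"
  hence XY: "padic_cauchy ?p X" "padic_cauchy ?p Y" "padic_null ?p (\<lambda>n. X n - Y n)"
    by (simp_all add: padicrel_def)
  show "lim (\<lambda>n. rat_ord ?p (X n)) = lim (\<lambda>n. rat_ord ?p (Y n))"
  proof (cases "padic_null ?p X")
    case True
    hence "padic_null ?p Y" using padic_null_diff[OF p _ XY(3), of X] by simp
    thus ?thesis using True padic_null_lim limI by metis
  next
    case False
    then obtain v N1 where v: "\<And>n. n \<ge> N1 \<Longrightarrow> rat_ord ?p (X n) = ereal v"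
      using padic_not_null_eventually_const[OF p XY(1)] by blast
    obtain N2 where 2: "\<forall>n\<ge>N2. ereal (v + 1) \<le> rat_ord ?p (Y n - X n)"
      using XY(3) unfolding padic_null_swap[of _ X Y] padic_null_def by meson
    have "rat_ord ?p (Y n) = ereal v" if n: "n \<ge> max N1 N2" for n
    proof -
      have "ereal v < ereal (v + 1)" by simp
      also have "\<dots> \<le> rat_ord ?p (Y n - X n)" using 2 n by simp
      finally have "rat_ord ?p (X n) < rat_ord ?p (Y n - X n)" using v n by simp
      from rat_ord_add_eq[OF p this] show ?thesis using v n by simp
    qed
    hence "(\<lambda>n. rat_ord ?p (Y n)) \<longlonglongrightarrow> ereal v"
      by (intro tendsto_eventually) (auto simp: eventually_sequentially intro: exI[of _ "max N1 N2"])
    moreover have "(\<lambda>n. rat_ord ?p (X n)) \<longlonglongrightarrow> ereal v"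
      using v by (intro tendsto_eventually) (auto simp: eventually_sequentially)
    ultimately show ?thesis using limI by metis
  qed
qed

definition padic_integers :: "'p::prime_card padic set" where
  "padic_integers = {x. 0 \<le> padic_ord x}"

lemma of_nat_padic: "of_nat k = Padic (\<lambda>n. of_nat k)"
proof (induction k)
  case 0
  show ?case by (simp add: zero_padic_def)
next
  case (Suc k)
  have "Padic (\<lambda>n. 1) + Padic (\<lambda>n. of_nat k) = (Padic (\<lambda>n. 1 + of_nat k) :: 'a padic)"
    by (rule plus_padic.abs_eq) (simp_all add: padicrel_def)
  thus ?case using Suc by (simp add: one_padic_def)
qed

instance padic :: (prime_card) field_char_0
proof (standard, rule injI)
  fix m n :: nat assume "(of_nat m :: 'a padic) = of_nat n"
  hence "padicrel TYPE('a) (\<lambda>_. of_nat m) (\<lambda>_. of_nat n)"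
    by (simp add: of_nat_padic Padic_eq_iff padicrel_def)
  thus "m = n" by (simp add: padicrel_def)
qed

lemma of_int_padic: "of_int k = Padic (\<lambda>n. of_int k)"
proof (cases k rule: int_diff_cases)
  case (diff a b)
  have 1: "- Padic (\<lambda>n. of_nat b) = (Padic (\<lambda>n. - of_nat b) :: 'a padic)"
    by (rule uminus_padic.abs_eq) (simp add: padicrel_def)
  have "Padic (\<lambda>n. of_nat a) + Padic (\<lambda>n. - of_nat b) = (Padic (\<lambda>n. of_nat a + - of_nat b) :: 'a padic)"
    by (rule plus_padic.abs_eq) (simp_all add: padicrel_def)
  thus ?thesis using 1 by (simp add: diff of_nat_padic minus_padic_def)
qed

lemma of_rat_padic: "of_rat x = Padic (\<lambda>n. x)"
proof (cases x)
  case (Fract a b)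
  have b: "(of_int b :: 'a padic) \<noteq> 0" using Fract by simp
  have "Padic (\<lambda>n. x) * Padic (\<lambda>n. of_int b) = (Padic (\<lambda>n. x * of_int b) :: 'a padic)"
    by (rule times_padic.abs_eq) (simp_all add: padicrel_def)
  also have "x * of_int b = of_int a" using Fract by (simp add: Fract_of_int_quotient)
  finally have "Padic (\<lambda>n. x) * of_int b = (of_int a :: 'a padic)" by (simp add: of_int_padic)
  thus ?thesis using b Fract by (simp add: of_rat_rat field_simps)
qed

lemma padic_ord_of_rat: "padic_ord (of_rat x :: 'p::prime_card padic) = rat_ord CARD('p) x"
proof -
  have "padic_ord (Padic (\<lambda>n. x) :: 'p padic) = lim (\<lambda>n. rat_ord CARD('p) x)"
    by (rule padic_ord.abs_eq) (simp add: padicrel_def)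
  also have "\<dots> = rat_ord CARD('p) x" by (rule limI) simp
  finally show ?thesis by (simp add: of_rat_padic)
qed

lemma padic_ord_of_int: "padic_ord (of_int k :: 'p::prime_card padic) = rat_ord CARD('p) (of_int k)"
  using padic_ord_of_rat[of "of_int k", where 'p = 'p] by simp

lemma padic_ord_eq_PInf_iff: "padic_ord (x :: 'p::prime_card padic) = \<infinity> \<longleftrightarrow> x = 0"
proof (transfer, goal_cases)
  case (1 X)
  note p = prime_card[where 'a = 'p]
  have X: "padic_cauchy CARD('p) X" using 1 by (simp add: padicrel_def)
  show ?case
  proof (cases "padic_null CARD('p) X")
    case True
    thus ?thesis using X padic_null_lim[OF True] limI[OF padic_null_lim[OF True]]
      by (simp add: padicrel_def)
  next
    case False
    then obtain v N where "\<forall>n\<ge>N. rat_ord CARD('p) (X n) = ereal v"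
      using padic_not_null_eventually_const[OF p X] by blast
    hence "(\<lambda>n. rat_ord CARD('p) (X n)) \<longlonglongrightarrow> ereal v"
      by (intro tendsto_eventually) (auto simp: eventually_sequentially)
    hence "lim (\<lambda>n. rat_ord CARD('p) (X n)) = ereal v" by (rule limI)
    thus ?thesis using False by (simp add: padicrel_def)
  qed
qed

lemma padic_ord_add:
  "min (padic_ord x) (padic_ord y) \<le> padic_ord (x + y :: 'p::prime_card padic)"
proof (transfer, goal_cases)
  case (1 X Y)
  note p = prime_card[where 'a = 'p]
  have XY: "padic_cauchy CARD('p) X" "padic_cauchy CARD('p) Y" using 1 by (simp_all add: padicrel_def)
  show ?case
    by (rule LIMSEQ_le[OF tendsto_min[OF padic_cauchy_convergent[OF p XY(1)]
          padic_cauchy_convergent[OF p XY(2)]] padic_cauchy_convergent[OF p padic_cauchy_add[OF p XY]]])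
      (use rat_ord_add[OF p] in blast)
qed

lemma padic_ord_mult: "padic_ord (x * y :: 'p::prime_card padic) = padic_ord x + padic_ord y"
proof (transfer, goal_cases)
  case (1 X Y)
  note p = prime_card[where 'a = 'p]
  have XY: "padic_cauchy CARD('p) X" "padic_cauchy CARD('p) Y" using 1 by (simp_all add: padicrel_def)
  have nM: "lim (\<lambda>n. rat_ord CARD('p) (Z n)) \<noteq> - \<infinity>" if Z: "padic_cauchy CARD('p) Z" for Z
  proof -
    obtain B where "\<And>n. ereal B \<le> rat_ord CARD('p) (Z n)" using padic_cauchy_bounded[OF p Z] by blast
    hence "ereal B \<le> lim (\<lambda>n. rat_ord CARD('p) (Z n))"
      by (intro LIMSEQ_le_const[OF padic_cauchy_convergent[OF p Z]]) blast
    thus ?thesis by auto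
  qed
  have "(\<lambda>n. rat_ord CARD('p) (X n) + rat_ord CARD('p) (Y n)) \<longlonglongrightarrow>
      lim (\<lambda>n. rat_ord CARD('p) (X n)) + lim (\<lambda>n. rat_ord CARD('p) (Y n))"
    by (rule tendsto_add_ereal_nonneg)
      (use nM[OF XY(1)] nM[OF XY(2)] padic_cauchy_convergent[OF p] XY in auto)
  hence "(\<lambda>n. rat_ord CARD('p) (X n * Y n)) \<longlonglongrightarrow>
      lim (\<lambda>n. rat_ord CARD('p) (X n)) + lim (\<lambda>n. rat_ord CARD('p) (Y n))"
    by (simp add: rat_ord_mult[OF p])
  thus ?case by (rule limI)
qed

end

theory Submission
  imports Defs
begin

text \<open>
  Write \<open>q = p\<^sup>\<alpha>\<close>. Up to the shift by \<open>r\<close>, the sum is \<open>\<Delta>\<^sup>n w\<close> for \<open>\<Delta> w(s) = w(s) - w(s + 1)\<close> and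
  \<open>w(k) = (k, q) f(\<lfloor>k/q\<rfloor>)\<close>. The polynomial ring \<open>\<int>[X]\<close> acts on functions on \<open>\<int>\<close>, with \<open>X\<close> acting
  as the shift, and \<open>T = X\<^sup>q - 1\<close> lowers the degree of \<open>f\<close>, so that \<open>T\<close> to the power \<open>l + 1\<close> kills \<open>w\<close>. Since
  \<open>\<Delta>\<close> is the action of \<open>1 - X\<close>, it suffices to see that \<open>(1 - X)\<^sup>n\<close> is divisible by a high power of
  \<open>p\<close> modulo that power of \<open>T\<close>.

  For \<open>\<alpha> = 1\<close> this is already the claimed bound. For \<open>\<alpha> \<ge> 2\<close> the gcd contributes a further
  \<open>\<alpha> - 1\<close>: decompose \<open>(k, q)\<close> into the indicators of \<open>p\<^sup>\<beta> | k\<close> with weights \<open>\<phi>(p\<^sup>\<beta>)\<close> and expand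
  \<open>\<Delta>\<^sup>n\<close> of the product by the Leibniz rule, where \<open>\<Delta>\<close> of \<open>f(\<lfloor>k/q\<rfloor>)\<close> is supported on one residue
  class modulo \<open>q\<close> and has lower degree.
\<close>

section \<open>Powers of \<open>1 - X\<close> modulo powers of \<open>X\<^sup>q - 1\<close>\<close>

definition ideal2 :: "'a::comm_ring_1 \<Rightarrow> 'a \<Rightarrow> 'a set" where
  "ideal2 a b = {a * x + b * y | x y. True}"

lemma ideal2I: "a * x + b * y \<in> ideal2 a b"
  by (auto simp: ideal2_def)

lemma ideal2_add: "u \<in> ideal2 a b \<Longrightarrow> v \<in> ideal2 a b \<Longrightarrow> u + v \<in> ideal2 a b"
proof -
  assume "u \<in> ideal2 a b" "v \<in> ideal2 a b"
  then obtain x y x' y' where "u = a * x + b * y" "v = a * x' + b * y'" by (auto simp: ideal2_def)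
  then have "u + v = a * (x + x') + b * (y + y')" by (simp add: algebra_simps)
  then show ?thesis using ideal2I by metis
qed

lemma ideal2_mult: "u \<in> ideal2 a b \<Longrightarrow> c * u \<in> ideal2 a b"
proof -
  assume "u \<in> ideal2 a b"
  then obtain x y where "u = a * x + b * y" by (auto simp: ideal2_def)
  then have "c * u = a * (c * x) + b * (c * y)" by (simp add: algebra_simps)
  then show ?thesis using ideal2I by metis
qed

lemma ideal2_one: "u \<in> ideal2 1 b"
  using ideal2I[of 1 u b 0] by simp

text \<open>Multiplying by a generator trades the pair of generators for another one: with
  \<open>c = P\<close> the power of \<open>P\<close> can grow, with \<open>c = T\<close> the power
  of \<open>T\<close>.\<close>

lemma ideal2_mult_left:
  assumes "u \<in> ideal2 a b" "a' dvd c * a" "b' dvd c * b"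
  shows "c * u \<in> ideal2 a' b'"
proof -
  from assms obtain x y i j where u: "u = a * x + b * y" and "c * a = a' * i" "c * b = b' * j"
    by (auto simp: ideal2_def elim!: dvdE)
  have "c * u = (c * a) * x + (c * b) * y" by (simp add: u algebra_simps)
  also have "\<dots> = a' * (i * x) + b' * (j * y)"
    by (simp add: \<open>c * a = a' * i\<close> \<open>c * b = b' * j\<close> mult.assoc)
  finally have "c * u = a' * (i * x) + b' * (j * y)" .
  then show ?thesis using ideal2I by metis
qed

text \<open>
  Multiplication by \<open>U\<^sup>m\<close> maps the ideal \<open>I\<close> generated by \<open>U\<^sup>k\<close> and \<open>W\<close> into \<open>P I + (T)\<close>. Passing
  to the next power of \<open>T\<close> costs a factor \<open>U\<^sup>k\<close>, which is needed to get back into \<open>I\<close>.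
\<close>
lemma power_mem_ideal2:
  fixes U W T P g h g' c d :: "'a::comm_ring_1" and k m :: nat
  assumes U: "U ^ m * U ^ k = P * (g * U ^ k + h * W) + c * T"
    and W: "U ^ m * W = P * (g' * W) + d * T"
    and m: "m > 0"
  shows "U ^ n \<in> ideal2 (P ^ ((n - (l + 1) * k) div m - l)) (T ^ (l + 1))"
proof (induction l arbitrary: n)
  case (0 n)
  \<comment> \<open>The inner induction follows the generators \<open>U ^ k\<close> and
    \<open>W\<close> together, because \<open>U ^ m\<close> sends \<open>U ^ k\<close> to a
    combination of both.\<close>
  have "U ^ n * U ^ k \<in> ideal2 (P ^ (n div m)) T \<and> U ^ n * W \<in> ideal2 (P ^ (n div m)) T" for n
  proof (induction n rule: less_induct)
    case (less n)
    show ?case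
    proof (cases "n < m")
      case True
      then show ?thesis by (simp add: ideal2_one)
    next
      case False
      define j where "j = n - m"
      have n: "n = j + m" using False j_def by simp
      let ?I = "ideal2 (P ^ (j div m)) T" and ?J = "ideal2 (P ^ (n div m)) T"
      have nd: "n div m = Suc (j div m)" using m n by simp
      have IH: "U ^ j * U ^ k \<in> ?I" "U ^ j * W \<in> ?I" using less[of j] n m by auto
      have up: "P * u + e * T \<in> ?J" if "u \<in> ?I" for u e
        using ideal2_add[OF ideal2_mult_left[OF that, of "P ^ (n div m)" P T]] ideal2I[of "P ^ (n div m)" 0 T e]
        by (simp add: nd mult.commute)
      have "U ^ n * U ^ k = P * (g * (U ^ j * U ^ k) + h * (U ^ j * W)) + (c * U ^ j) * T"
        using arg_cong[OF U, of "\<lambda>z. U ^ j * z"] by (simp add: n power_add algebra_simps)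
      moreover have "U ^ n * W = P * (g' * (U ^ j * W)) + (d * U ^ j) * T"
        using arg_cong[OF W, of "\<lambda>z. U ^ j * z"] by (simp add: n power_add algebra_simps)
      ultimately show ?thesis using IH up by (simp add: ideal2_add ideal2_mult)
    qed
  qed
  then have "U ^ (n - k) * U ^ k \<in> ideal2 (P ^ ((n - k) div m)) T" by blast
  then show ?case
    by (cases "k \<le> n") (simp_all add: ideal2_one flip: power_add)
next
  case (Suc l n)
  \<comment> \<open>Splitting \<open>U ^ n\<close> as \<open>U ^ (n - k) * U ^ k\<close> costs one
    more \<open>k\<close>, so the exponent wanted for \<open>Suc l\<close> is
    \<open>e (n - k)\<close>.\<close>
  define e where "e n = (n - Suc l * k) div m - Suc l" for n
  have "U ^ n * U ^ k \<in> ideal2 (P ^ e n) (T ^ (l + 2)) \<and> U ^ n * W \<in> ideal2 (P ^ e n) (T ^ (l + 2))" for n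
  proof (induction n rule: less_induct)
    case (less n)
    show ?case
    proof (cases "n - Suc l * k < m")
      case True
      then show ?thesis by (simp add: e_def ideal2_one)
    next
      case False
      define j where "j = n - m"
      have n: "n = j + m" using False j_def by simp
      let ?I = "ideal2 (P ^ e j) (T ^ (l + 2))" and ?J = "ideal2 (P ^ e n) (T ^ (l + 2))"
      have "n - Suc l * k = (j - Suc l * k) + m" using False n by simp
      then have nd: "(n - Suc l * k) div m = Suc ((j - Suc l * k) div m)" using m by simp
      have IH: "U ^ j * U ^ k \<in> ?I" "U ^ j * W \<in> ?I" using less[of j] n m by auto
      \<comment> \<open>The outer hypothesis at \<open>j = n - m\<close> gives exactly
        \<open>e n\<close>: the quotient drops by one, and \<open>l\<close> is subtracted in place
        of \<open>Suc l\<close>.\<close>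
      have "U ^ j \<in> ideal2 (P ^ e n) (T ^ (l + 1))"
        using Suc.IH[of j] by (simp only: e_def nd diff_Suc_Suc Suc_eq_plus1[symmetric])
      then have T: "T * U ^ j \<in> ?J"
        by (rule ideal2_mult_left) simp_all
      \<comment> \<open>Truncation at \<open>0\<close> can make \<open>e n\<close> smaller than
        \<open>Suc (e j)\<close>, hence divisibility in place of equality.\<close>
      have "P ^ e n dvd P * P ^ e j"
        using le_imp_power_dvd[of "e n" "Suc (e j)" P] nd by (simp add: e_def)
      then have P: "P * u \<in> ?J" if "u \<in> ?I" for u
        by (rule ideal2_mult_left[OF that]) simp
      have up: "P * u + e * (T * U ^ j) \<in> ?J" if "u \<in> ?I" for u e
        using ideal2_add[OF P[OF that] ideal2_mult[OF T]] .
      have "U ^ n * U ^ k = P * (g * (U ^ j * U ^ k) + h * (U ^ j * W)) + c * (T * U ^ j)"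
        using arg_cong[OF U, of "\<lambda>z. U ^ j * z"] by (simp add: n power_add algebra_simps)
      moreover have "U ^ n * W = P * (g' * (U ^ j * W)) + d * (T * U ^ j)"
        using arg_cong[OF W, of "\<lambda>z. U ^ j * z"] by (simp add: n power_add algebra_simps)
      ultimately show ?thesis using IH up by (simp add: ideal2_add ideal2_mult)
    qed
  qed
  then have "U ^ (n - k) * U ^ k \<in> ideal2 (P ^ e (n - k)) (T ^ (l + 2))" by blast
  then show ?case
    by (cases "k \<le> n") (simp_all add: ideal2_one e_def add.commute flip: power_add)
qed

section \<open>Congruences modulo \<open>p\<close> for powers of \<open>1 - x\<close>\<close>

lemma prime_dvd_one_minus_power:
  fixes y :: "'a::comm_ring_1"
  assumes p: "prime p"
  shows "of_nat p dvd (1 - y) ^ p - (1 - y ^ p)"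
proof -
  have p1: "p \<ge> 1" using p prime_ge_1_nat by blast
  have "(1 - y) ^ p = (\<Sum>i\<le>p. of_nat (p choose i) * (- y) ^ i)"
    using binomial_ring[of "-y" 1 p] by simp
  also have "\<dots> = 1 + (\<Sum>i\<in>{0<..<p}. of_nat (p choose i) * (- y) ^ i) + (- y) ^ p"
  proof -
    have "{..p} = insert 0 (insert p {0<..<p})" using p1 by auto
    then show ?thesis using p1 by simp
  qed
  finally have eq: "(1 - y) ^ p - (1 - y ^ p) =
    (\<Sum>i\<in>{0<..<p}. of_nat (p choose i) * (- y) ^ i) + ((- y) ^ p + y ^ p)" by simp
  have 1: "of_nat p dvd (\<Sum>i\<in>{0<..<p}. of_nat (p choose i) * (- y) ^ i)"
  proof (rule dvd_sum)
    fix i assume "i \<in> {0<..<p}"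
    then have "p dvd p choose i" using dvd_choose_prime[of i p] p by simp
    then show "of_nat p dvd of_nat (p choose i) * (- y) ^ i"
      by (intro dvd_mult2) (auto elim!: dvdE)
  qed
  \<comment> \<open>The sum is \<open>0\<close> for odd \<open>p\<close> and
    \<open>2 * y ^ 2\<close> for \<open>p = 2\<close>.\<close>
  have 2: "of_nat p dvd (- y) ^ p + y ^ p"
  proof (cases "p = 2")
    case True
    then show ?thesis by (simp flip: mult_2)
  next
    case False
    then have "odd p" using p prime_odd_nat prime_ge_2_nat le_neq_implies_less by metis
    then show ?thesis by simp
  qed
  show ?thesis unfolding eq using 1 2 by (rule dvd_add)
qed

text \<open>Since \<open>u - v\<close> divides \<open>u ^ p - v ^ p\<close>, a congruence modulo
  \<open>p\<close> survives taking \<open>p\<close>-th powers; the prime case at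
  \<open>x ^ p ^ a\<close> then supplies the next exponent.\<close>

lemma prime_dvd_one_minus_power_prime_power:
  fixes x :: "'a::comm_ring_1"
  assumes p: "prime p"
  shows "of_nat p dvd (1 - x) ^ p ^ a - (1 - x ^ p ^ a)"
proof (induction a)
  case (Suc a)
  have "(1 - x) ^ p ^ a - (1 - x ^ p ^ a) dvd ((1 - x) ^ p ^ a) ^ p - (1 - x ^ p ^ a) ^ p"
    by (metis power_diff_sumr2 dvd_triv_left)
  then have "of_nat p dvd ((1 - x) ^ p ^ a) ^ p - (1 - x ^ p ^ a) ^ p"
    using Suc dvd_trans by blast
  from dvd_add[OF this prime_dvd_one_minus_power[OF p, of "x ^ p ^ a"]]
  have "of_nat p dvd ((1 - x) ^ p ^ a) ^ p - (1 - (x ^ p ^ a) ^ p)"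
    by (simp only: diff_add_cancel add_diff_eq)
  then show ?case by (simp only: power_mult[symmetric] power_Suc2)
qed simp

lemma dvd_diffE:
  fixes a b c :: "'a::comm_ring_1"
  assumes "c dvd a - b"
  obtains k where "a = b + c * k"
  using assms by (metis dvdE add.commute diff_eq_eq)

text \<open>The instance \<open>U = 1 - X\<close>, \<open>k = p ^ a\<close>,
  \<open>m = p ^ a * (p - 1)\<close>, \<open>P = p\<close> of \<open>power_mem_ideal2\<close>, with
  \<open>W\<close> cyclotomic. Modulo \<open>p\<close>, \<open>U ^ k\<close> is \<open>1 - y\<close>
  and \<open>U ^ m\<close> is \<open>W\<close>, so that \<open>U ^ m * U ^ k\<close> is
  \<open>- T\<close>; and \<open>W * W\<close> is \<open>p * W\<close> modulo
  \<open>T\<close>.\<close>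

lemma one_minus_X_power_mem_ideal2:
  fixes p a l n :: nat
  assumes p: "prime p"
  shows "(1 - [:0, 1:] :: int poly) ^ n \<in> ideal2 (of_nat p ^ ((n - (l + 1) * p ^ a) div (p ^ a * (p - 1)) - l))
           (([:0, 1:] ^ p ^ Suc a - 1) ^ (l + 1))"
proof -
  define U where "U = (1 - [:0, 1:] :: int poly)"
  define y where "y = ([:0, 1:] :: int poly) ^ p ^ a"
  define T where "T = ([:0, 1:] :: int poly) ^ p ^ Suc a - 1"
  define W where "W = (\<Sum>i<p. y ^ i)" \<comment> \<open>the cyclotomic polynomial of order \<open>p ^ Suc a\<close>\<close>
  let ?P = "of_nat p :: int poly"
  have T: "T = (y - 1) * W"
    using power_diff_1_eq[of y p] by (simp only: T_def W_def y_def power_mult[symmetric] power_Suc2)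
  obtain h where h: "U ^ p ^ a = (1 - y) + ?P * h"
    using dvd_diffE[OF prime_dvd_one_minus_power_prime_power[OF p, of "[:0, 1:] :: int poly" a]]
    unfolding U_def y_def .
  obtain h' where h': "U ^ p ^ Suc a = - T + ?P * h'"
    using dvd_diffE[OF prime_dvd_one_minus_power_prime_power[OF p, of "[:0, 1:] :: int poly" "Suc a"]]
    unfolding U_def T_def minus_diff_eq .
  have s: "p ^ a * (p - 1) + p ^ a = p ^ Suc a"
    using prime_ge_1_nat[OF p] by (simp add: algebra_simps)
  \<comment> \<open>Modulo \<open>p\<close> both \<open>U ^ p ^ Suc a\<close> and
    \<open>U ^ p ^ a * W\<close> equal \<open>- T\<close>. As \<open>p\<close> is a prime element of
    the polynomial ring and does not divide \<open>U\<close>, the factor \<open>U ^ p ^ a\<close>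
    can be cancelled afterwards.\<close>
  have "U ^ p ^ a * (U ^ (p ^ a * (p - 1)) - W) = ?P * (h' - h * W)"
  proof -
    have "U ^ p ^ a * (U ^ (p ^ a * (p - 1)) - W) = U ^ p ^ Suc a - U ^ p ^ a * W"
      by (simp only: right_diff_distrib power_add[symmetric] s add.commute[of "p ^ a" "p ^ a * (p - 1)"])
    also have "\<dots> = - ((y - 1) * W) + ?P * h' - ((1 - y) + ?P * h) * W"
      by (simp only: h h' T)
    also have "\<dots> = ?P * (h' - h * W)"
      by (simp add: ring_distribs)
    finally show ?thesis .
  qed
  then have "?P dvd U ^ p ^ a * (U ^ (p ^ a * (p - 1)) - W)" by simp
  moreover have "prime_elem ?P"
    using p prime_elem_const_poly_iff[of "int p"] by (simp add: of_nat_poly)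
  moreover have "\<not> ?P dvd U"
    using p const_poly_dvd_iff[of "int p" U] by (auto simp: U_def of_nat_poly intro: exI[of _ 0])
  ultimately have "?P dvd U ^ (p ^ a * (p - 1)) - W"
    using prime_elem_dvd_mult_iff prime_elem_dvd_power by blast
  then obtain g where g: "U ^ (p ^ a * (p - 1)) = W + ?P * g" by (rule dvd_diffE)
  \<comment> \<open>At \<open>y = 1\<close> the sum \<open>W\<close> of \<open>p\<close> powers of
    \<open>y\<close> takes the value \<open>p\<close>.\<close>
  have "y - 1 dvd W - ?P"
  proof -
    have "W - ?P = (\<Sum>i<p. y ^ i - 1)" by (simp add: W_def sum_subtractf)
    moreover have "y - 1 dvd y ^ i - 1" for i
      unfolding power_diff_1_eq[of y i] by simp
    ultimately show ?thesis by (simp add: dvd_sum)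
  qed
  then obtain d where d: "W = ?P + (y - 1) * d" by (rule dvd_diffE)
  show ?thesis unfolding U_def[symmetric] T_def[symmetric]
  proof (rule power_mem_ideal2)
    show "U ^ (p ^ a * (p - 1)) * U ^ p ^ a = ?P * (g * U ^ p ^ a + h * W) + (- 1) * T"
      unfolding g h T by (simp add: ring_distribs)
    have "W * W = ?P * W + (y - 1) * d * W" using d by (metis distrib_right)
    then show "U ^ (p ^ a * (p - 1)) * W = ?P * ((1 + g) * W) + d * T"
      unfolding g T ring_distribs by (simp add: mult_ac)
    show "p ^ a * (p - 1) > 0" using prime_gt_1_nat[OF p] by simp
  qed
qed


section \<open>The action of integer polynomials on functions\<close>

text \<open>The negative of the usual forward difference: the \<open>n\<close>-th iterate then
  carries the signs \<open>(- 1) ^ k\<close>, with no extra factor \<open>(- 1) ^ n\<close>.\<close>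

definition shift_diff :: "(int \<Rightarrow> 'a::ab_group_add) \<Rightarrow> int \<Rightarrow> 'a" where
  "shift_diff w s = w s - w (s + 1)"

definition poly_act :: "int poly \<Rightarrow> (int \<Rightarrow> 'a::comm_ring_1) \<Rightarrow> int \<Rightarrow> 'a" where
  "poly_act P w s = (\<Sum>i\<le>degree P. of_int (coeff P i) * w (s + int i))"

lemma poly_act_0 [simp]: "poly_act 0 w = (\<lambda>_. 0)"
  by (simp add: poly_act_def fun_eq_iff)

lemma poly_act_zero_fun [simp]: "poly_act P (\<lambda>_. 0) = (\<lambda>_. 0)"
  by (simp add: poly_act_def fun_eq_iff)

lemma poly_act_pCons: "poly_act (pCons a P) w s = of_int a * w s + poly_act P w (s + 1)"
proof (cases "P = 0")
  case False
  then have "poly_act (pCons a P) w s = (\<Sum>i\<le>Suc (degree P). of_int (coeff (pCons a P) i) * w (s + int i))"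
    by (simp add: poly_act_def)
  then show ?thesis by (simp add: sum.atMost_Suc_shift poly_act_def add.assoc del: sum.atMost_Suc)
qed (simp add: poly_act_def)

lemma poly_act_1 [simp]: "poly_act 1 w = w"
  by (simp add: one_pCons poly_act_pCons fun_eq_iff)

lemma poly_act_add: "poly_act (P + Q) w s = poly_act P w s + poly_act Q w s"
  by (induction P Q arbitrary: s rule: poly_induct2) (simp_all add: poly_act_pCons algebra_simps)

lemma poly_act_smult: "poly_act (smult c P) w s = of_int c * poly_act P w s"
  by (induction P arbitrary: s) (simp_all add: poly_act_pCons algebra_simps)

lemma poly_act_of_int_mult: "poly_act (of_int c * P) w s = of_int c * poly_act P w s"
  using poly_act_smult[of c P w s] by (simp add: of_int_poly)

lemma poly_act_diff: "poly_act (P - Q) w s = poly_act P w s - poly_act Q w s"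
  using poly_act_add[of P "- Q" w s] poly_act_smult[of "-1" Q w s] by simp

lemma poly_act_sum: "poly_act (\<Sum>i\<in>A. P i) w s = (\<Sum>i\<in>A. poly_act (P i) w s)"
  by (induction A rule: infinite_finite_induct) (simp_all add: poly_act_add)

lemma poly_act_mult: "poly_act (P * Q) w s = poly_act P (poly_act Q w) s"
  by (induction P arbitrary: s) (simp_all add: poly_act_pCons poly_act_add poly_act_smult)

lemma poly_act_X_power: "poly_act ([:0, 1:] ^ n) w s = w (s + int n)"
  by (induction n arbitrary: s) (simp_all add: poly_act_pCons ac_simps)

lemma poly_act_one_minus_X_power: "poly_act ((1 - [:0, 1:]) ^ n) w = (shift_diff ^^ n) w"
proof (induction n)
  case (Suc n)
  have "poly_act (1 - [:0, 1:]) v = shift_diff v" for v :: "int \<Rightarrow> 'a"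
    using poly_act_X_power[of 1 v] by (simp add: fun_eq_iff poly_act_diff shift_diff_def)
  then show ?case using Suc by (simp add: poly_act_mult[abs_def])
qed simp

section \<open>Binomial expansion and linearity of iterated differences\<close>

lemma shift_diff_funpow_eq_sum:
  fixes w :: "int \<Rightarrow> 'a::comm_ring_1"
  shows "(shift_diff ^^ n) w s = (\<Sum>k=0..n. of_nat (n choose k) * (- 1) ^ k * w (s + int k))"
proof -
  have "(1 - [:0, 1:] :: int poly) ^ n = (\<Sum>k\<le>n. of_nat (n choose k) * (- [:0, 1:]) ^ k)"
    using binomial_ring[of "- [:0, 1:] :: int poly" 1 n]
    by (simp only: power_one mult_1_right uminus_add_conv_diff)
  also have "\<dots> = (\<Sum>k\<le>n. of_int (int (n choose k) * (- 1) ^ k) * [:0, 1:] ^ k)"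
    by (intro sum.cong refl) (subst power_minus, simp)
  finally show ?thesis
    unfolding poly_act_one_minus_X_power[symmetric] atLeast0AtMost
    by (simp only: poly_act_sum poly_act_of_int_mult poly_act_X_power) simp
qed

lemma shift_diff_funpow_add:
  "(shift_diff ^^ n) (\<lambda>k. u k + v k) s = (shift_diff ^^ n) u s + (shift_diff ^^ n) v s"
  by (induction n arbitrary: s) (simp_all add: shift_diff_def)

lemma shift_diff_funpow_cmult:
  fixes u :: "int \<Rightarrow> 'a::comm_ring_1"
  shows "(shift_diff ^^ n) (\<lambda>k. c * u k) s = c * (shift_diff ^^ n) u s"
  by (induction n arbitrary: s) (simp_all add: shift_diff_def algebra_simps)

lemma shift_diff_funpow_shift:
  "(shift_diff ^^ n) (\<lambda>k. u (k + 1)) s = (shift_diff ^^ n) u (s + 1)"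
  by (induction n arbitrary: s) (simp_all add: shift_diff_def)

lemma shift_diff_funpow_zero: "(shift_diff ^^ n) (\<lambda>_. 0) = (\<lambda>_. 0)"
  by (induction n) (simp_all add: shift_diff_def fun_eq_iff)

lemma shift_diff_funpow_const: "n > 0 \<Longrightarrow> (shift_diff ^^ n) (\<lambda>_. c) = (\<lambda>_. 0)"
proof (cases n)
  case (Suc m)
  have "shift_diff (\<lambda>_. c) = (\<lambda>_. 0)" by (simp add: shift_diff_def fun_eq_iff)
  then show ?thesis unfolding Suc funpow_Suc_right o_apply by (simp add: shift_diff_funpow_zero)
qed simp

text \<open>Substituting \<open>x + 1\<close> preserves degree and leading coefficient, so the top
  terms cancel.\<close>

lemma degree_forward_diff_le:
  fixes f :: "'a::idom poly"
  assumes "degree f \<le> Suc l"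
  shows "degree (pcompose f [:1, 1:] - f) \<le> l"
proof (intro degree_le allI impI)
  fix i assume i: "l < i"
  have d: "degree (pcompose f [:1, 1:]) = degree f" by (simp add: degree_pcompose)
  have lc: "lead_coeff (pcompose f [:1, 1:]) = lead_coeff f" by (subst lead_coeff_comp) simp_all
  show "coeff (pcompose f [:1, 1:] - f) i = 0"
  proof (cases "i = degree f")
    case True
    then show ?thesis using lc d by simp
  next
    case False
    then have "degree f < i" using i assms by simp
    then show ?thesis using d by (simp add: coeff_eq_0)
  qed
qed

text \<open>A shift by \<open>q\<close> leaves \<open>c\<close> alone and raises
  \<open>k div q\<close> by one. Hence \<open>X ^ q - 1\<close> replaces \<open>f\<close> by its
  forward difference, and \<open>l + 1\<close> such steps leave nothing.\<close>

lemma poly_act_periodic_mult_poly_div: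
  fixes f :: "'a::idom poly" and c :: "int \<Rightarrow> 'a"
  assumes c: "\<And>k. c (k + int q) = c k" and q: "q > 0" and "degree f \<le> l"
  shows "poly_act (([:0, 1:] ^ q - 1) ^ (l + 1)) (\<lambda>k. c k * poly f (of_int (k div int q))) = (\<lambda>_. 0)"
  using assms(3)
proof (induction l arbitrary: f)
  case (0 f)
  then obtain b where "f = [:b:]" by (metis le_zero_eq degree_eq_zeroE)
  then show ?case using c by (simp add: fun_eq_iff poly_act_diff poly_act_X_power)
next
  case (Suc l f)
  let ?w = "\<lambda>k. c k * poly f (of_int (k div int q))"
  have "poly_act ([:0, 1:] ^ q - 1) ?w =
    (\<lambda>k. c k * poly (pcompose f [:1, 1:] - f) (of_int (k div int q)))"
    using c q by (simp add: fun_eq_iff poly_act_diff poly_act_X_power poly_pcompose algebra_simps)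
  then have "poly_act (([:0, 1:] ^ q - 1) ^ (l + 1)) (poly_act ([:0, 1:] ^ q - 1) ?w) = (\<lambda>_. 0)"
    using Suc.IH[OF degree_forward_diff_le[OF Suc.prems]] by simp
  then show ?case unfolding add_Suc power_Suc2 by (simp add: poly_act_mult[abs_def])
qed

section \<open>The \<open>p\<close>-adic order of iterated differences\<close>

lemma padic_ord_0 [simp]: "padic_ord 0 = \<infinity>"
  by (simp add: padic_ord_eq_PInf_iff)

lemma padic_ord_minus [simp]: "padic_ord (- x) = padic_ord x"
proof -
  have "padic_ord (- 1 :: 'a padic) = 0"
    using padic_ord_of_int[of "-1", where 'p = 'a] prime_card[where 'a = 'a] by simp
  then show ?thesis using padic_ord_mult[of "- 1" x] by simp
qed

lemma padic_ord_add_ge: "c \<le> padic_ord x \<Longrightarrow> c \<le> padic_ord y \<Longrightarrow> c \<le> padic_ord (x + y)"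
  using padic_ord_add[of x y] by (meson min.boundedI order_trans)

lemma padic_ord_diff_ge: "c \<le> padic_ord x \<Longrightarrow> c \<le> padic_ord y \<Longrightarrow> c \<le> padic_ord (x - y)"
  using padic_ord_add_ge[of c x "- y"] by simp

lemma padic_ord_mult_ge:
  assumes "ereal a \<le> padic_ord x" "ereal b \<le> padic_ord y"
  shows "ereal (a + b) \<le> padic_ord (x * y)"
  using add_mono[OF assms] by (simp add: padic_ord_mult)

lemma padic_ord_sum_ge: "(\<And>i. i \<in> A \<Longrightarrow> c \<le> padic_ord (g i)) \<Longrightarrow> c \<le> padic_ord (\<Sum>i\<in>A. g i)"
  by (induction A rule: infinite_finite_induct) (simp_all add: padic_ord_add_ge)

lemma padic_ord_of_int_nonneg: "0 \<le> padic_ord (of_int k)"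
  using rat_ord_of_int_ge_iff[OF prime_card[where 'a = 'a], of 0 k]
  by (simp add: padic_ord_of_int zero_ereal_def)

lemma padic_ord_CARD_power_ge: "ereal (real e) \<le> padic_ord (of_nat CARD('p) ^ e :: 'p::prime_card padic)"
  using rat_ord_of_int_ge_iff[OF prime_card[where 'a = 'p], of e "int CARD('p) ^ e"]
    padic_ord_of_int[of "int CARD('p) ^ e", where 'p = 'p] by simp

lemma padic_ord_nonneg_mult: "0 \<le> padic_ord x \<Longrightarrow> 0 \<le> padic_ord y \<Longrightarrow> 0 \<le> padic_ord (x * y)"
  by (simp add: padic_ord_mult)

lemma padic_ord_poly_act_nonneg:
  assumes "\<And>s. 0 \<le> padic_ord (w s)"
  shows "0 \<le> padic_ord (poly_act P w s)"
  unfolding poly_act_def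
  by (intro padic_ord_sum_ge padic_ord_nonneg_mult padic_ord_of_int_nonneg assms)

lemma padic_ord_shift_diff_funpow_nonneg:
  assumes "\<And>s. 0 \<le> padic_ord (w s)"
  shows "0 \<le> padic_ord ((shift_diff ^^ n) w s)"
  unfolding poly_act_one_minus_X_power[symmetric] using assms by (rule padic_ord_poly_act_nonneg)

text \<open>Write \<open>(1 - X) ^ n\<close> as \<open>p ^ e * A + T ^ (l + 1) * B\<close>. The
  second term kills \<open>w\<close>; the first contributes \<open>e\<close>, as \<open>A\<close>
  has integer coefficients and \<open>w\<close> has integral values.\<close>

lemma padic_ord_shift_diff_funpow_ge:
  fixes w :: "int \<Rightarrow> 'p::prime_card padic"
  assumes p: "p = CARD('p)" and w: "\<And>s. 0 \<le> padic_ord (w s)"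
    and T: "poly_act (([:0, 1:] ^ p ^ Suc a - 1) ^ (l + 1)) w = (\<lambda>_. 0)"
  shows "ereal (real ((n - (l + 1) * p ^ a) div (p ^ a * (p - 1)) - l)) \<le> padic_ord ((shift_diff ^^ n) w s)"
    (is "ereal (real ?e) \<le> _")
proof -
  have "prime p" using p prime_card[where 'a = 'p] by simp
  from one_minus_X_power_mem_ideal2[OF this, of n l a] obtain A B where
    AB: "(1 - [:0, 1:] :: int poly) ^ n = of_nat p ^ ?e * A + ([:0, 1:] ^ p ^ Suc a - 1) ^ (l + 1) * B"
    unfolding ideal2_def by auto
  have "(shift_diff ^^ n) w s = poly_act (of_int (int p ^ ?e) * A) w s
      + poly_act (B * ([:0, 1:] ^ p ^ Suc a - 1) ^ (l + 1)) w s"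
    unfolding poly_act_one_minus_X_power[symmetric] AB poly_act_add by (simp add: mult.commute)
  also have "\<dots> = of_nat p ^ ?e * poly_act A w s"
    unfolding poly_act_of_int_mult poly_act_mult[of B] T by simp
  finally have "(shift_diff ^^ n) w s = of_nat p ^ ?e * poly_act A w s" .
  moreover have "ereal (real ?e + 0) \<le> padic_ord (of_nat p ^ ?e * poly_act A w s)"
    using padic_ord_CARD_power_ge[of ?e, where 'p = 'p] padic_ord_poly_act_nonneg[where w = w and P = A and s = s] w
    by (intro padic_ord_mult_ge) (simp_all add: p flip: zero_ereal_def)
  ultimately show ?thesis by simp
qed

text \<open>An ultrametric Leibniz rule, from \<Delta>(uv)(k) = \<Delta>u(k) v(k) + u(k + 1)
  \<Delta>v(k). Only orders matter, so no binomial coefficients appear; independent points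
  \<open>s\<close> and \<open>t\<close> absorb the shift of \<open>u\<close>.\<close>

lemma padic_ord_shift_diff_funpow_mult_ge:
  fixes u v :: "int \<Rightarrow> 'p::prime_card padic"
  assumes "\<And>i s t. i \<le> n \<Longrightarrow> c \<le> padic_ord ((shift_diff ^^ (n - i)) u s * (shift_diff ^^ i) v t)"
  shows "c \<le> padic_ord ((shift_diff ^^ n) (\<lambda>k. u k * v k) s)"
  using assms
proof (induction n arbitrary: u v s)
  case 0
  show ?case using 0[of 0 s s] by simp
next
  case (Suc n)
  have eq: "shift_diff (\<lambda>k. u k * v k) = (\<lambda>k. shift_diff u k * v k + u (k + 1) * shift_diff v k)"
    by (simp add: shift_diff_def fun_eq_iff algebra_simps)
  have "c \<le> padic_ord ((shift_diff ^^ n) (\<lambda>k. shift_diff u k * v k) s)"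
  proof (rule Suc.IH)
    fix i s t assume "i \<le> n"
    then show "c \<le> padic_ord ((shift_diff ^^ (n - i)) (shift_diff u) s * (shift_diff ^^ i) v t)"
      using Suc.prems[of i s t] by (simp add: Suc_diff_le funpow_Suc_right del: funpow.simps)
  qed
  moreover have "c \<le> padic_ord ((shift_diff ^^ n) (\<lambda>k. u (k + 1) * shift_diff v k) s)"
  proof (rule Suc.IH)
    fix i s t assume "i \<le> n"
    then show "c \<le> padic_ord ((shift_diff ^^ (n - i)) (\<lambda>k. u (k + 1)) s * (shift_diff ^^ i) (shift_diff v) t)"
      using Suc.prems[of "Suc i" "s + 1" t] by (simp add: shift_diff_funpow_shift funpow_Suc_right del: funpow.simps)
  qed
  ultimately show ?case
    by (simp add: funpow_Suc_right eq shift_diff_funpow_add padic_ord_add_ge del: funpow.simps)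
qed


section \<open>Iterated differences of indicators and of the gcd\<close>

lemma padic_ord_shift_diff_funpow_dvd_ge:
  assumes p: "p = CARD('p::prime_card)"
  shows "ereal (real ((n - p ^ a) div (p ^ a * (p - 1))))
    \<le> padic_ord ((shift_diff ^^ n) (\<lambda>k. of_bool (int (p ^ Suc a) dvd k) :: 'p padic) s)"
proof -
  \<comment> \<open>By periodicity the first power of \<open>X ^ p ^ Suc a - 1\<close> already kills
    the indicator, so the general bound applies with \<open>l = 0\<close>.\<close>
  have per: "poly_act ([:0, 1:] ^ p ^ Suc a - 1) (\<lambda>k. of_bool (int (p ^ Suc a) dvd k) :: 'p padic) = (\<lambda>_. 0)"
    by (simp only: fun_eq_iff poly_act_diff poly_act_X_power poly_act_1 dvd_add_triv_right_iff diff_self simp_thms)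
  have "0 \<le> padic_ord (of_bool (int (p ^ Suc a) dvd k) :: 'p padic)" for k
    using padic_ord_of_int_nonneg[of "of_bool (int (p ^ Suc a) dvd k)", where 'a = 'p] by simp
  from padic_ord_shift_diff_funpow_ge[OF p this, where a = a and l = 0] show ?thesis
    using per by simp
qed

text \<open>Raising the exponent changes the gcd only at multiples of \<open>p ^ Suc a\<close>,
  where it grows from \<open>p ^ a\<close> to \<open>p ^ Suc a\<close>.\<close>

lemma gcd_prime_power_Suc:
  fixes k :: int
  assumes p: "prime p"
  shows "gcd k (int (p ^ Suc a)) = gcd k (int (p ^ a)) + int (p ^ a * (p - 1)) * of_bool (int (p ^ Suc a) dvd k)"
proof (cases "int (p ^ Suc a) dvd k")
  case True
  then have "int (p ^ a) dvd k" using dvd_trans le_imp_power_dvd[of a "Suc a" "int p"] by fastforce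
  moreover have "p ^ a * (p - 1) + p ^ a = p ^ Suc a"
    using prime_ge_1_nat[OF p] by (simp add: algebra_simps)
  then have "int (p ^ a) + int (p ^ a * (p - 1)) = int (p ^ Suc a)"
    by (metis of_nat_add add.commute)
  moreover have "gcd k (int m) = int m" if "int m dvd k" for m
    using that by (simp add: gcd_proj2_iff)
  ultimately show ?thesis using True by (simp del: power_Suc of_nat_power of_nat_mult)
next
  case False
  have pp: "prime (int p)" using p by simp
  have "gcd k (int p ^ Suc a) dvd int p ^ Suc a" by simp
  then obtain i where i: "i \<le> Suc a" "gcd k (int p ^ Suc a) = int p ^ i"
    using divides_primepow[OF pp] by (metis normalize_gcd normalize_power normalize_prime)
  have "i \<noteq> Suc a" using i(2) False by (metis gcd_dvd1 of_nat_power)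
  then have "int p ^ i dvd int p ^ a" using i(1) by (intro le_imp_power_dvd) simp
  moreover have "int p ^ i dvd k" using i(2) by (metis gcd_dvd1)
  ultimately have "gcd k (int p ^ Suc a) dvd gcd k (int p ^ a)" using i(2) by simp
  moreover have "gcd k (int p ^ a) dvd gcd k (int p ^ Suc a)"
    by (intro gcd_greatest gcd_dvd1 dvd_trans[OF gcd_dvd2] le_imp_power_dvd) simp
  ultimately have "gcd k (int p ^ Suc a) = gcd k (int p ^ a)"
    by (intro zdvd_antisym_nonneg) simp_all
  then show ?thesis using False by (simp del: power_Suc)
qed

text \<open>Peel off one indicator at a time: at level \<open>b\<close> its weight contributes
  \<open>b\<close> and its differences contribute \<open>N\<close>. At the bottom the gcd with
  \<open>1\<close> is constant, and its differences vanish because \<open>n > 0\<close>.\<close>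

lemma padic_ord_shift_diff_funpow_gcd_ge:
  assumes p: "p = CARD('p::prime_card)" and n: "p ^ a + N * (p ^ a * (p - 1)) \<le> n"
  shows "ereal (real (N + a)) \<le> padic_ord ((shift_diff ^^ n) (\<lambda>k. of_int (gcd k (int (p ^ Suc a))) :: 'p padic) s)"
proof -
  have pr: "prime p" using p prime_card[where 'a = 'p] by simp
  have n0: "n > 0" if "p ^ b + M \<le> n" for b M
    using that prime_gt_0_nat[OF pr] by (metis add_gr_0 less_le_trans zero_less_power)
  have split: "(shift_diff ^^ n) (\<lambda>k. of_int (gcd k (int (p ^ Suc b))) :: 'p padic) s =
      (shift_diff ^^ n) (\<lambda>k. of_int (gcd k (int (p ^ b)))) s +
      of_int (int (p ^ b * (p - 1))) * (shift_diff ^^ n) (\<lambda>k. of_bool (int (p ^ Suc b) dvd k)) s" for b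
    unfolding gcd_prime_power_Suc[OF pr] of_int_add of_int_mult of_int_of_bool
    by (simp only: shift_diff_funpow_add shift_diff_funpow_cmult)
  have new: "ereal (real (N + b)) \<le> padic_ord (of_int (int (p ^ b * (p - 1))) *
      (shift_diff ^^ n) (\<lambda>k. of_bool (int (p ^ Suc b) dvd k) :: 'p padic) s)"
    if le: "p ^ b + N * (p ^ b * (p - 1)) \<le> n" for b N
  proof -
    have "0 < p ^ b * (p - 1)" using prime_gt_1_nat[OF pr] by simp
    then have "N \<le> (n - p ^ b) div (p ^ b * (p - 1))"
      using le by (simp add: less_eq_div_iff_mult_less_eq)
    then have "ereal (real N) \<le> padic_ord ((shift_diff ^^ n) (\<lambda>k. of_bool (int (p ^ Suc b) dvd k) :: 'p padic) s)"
      by (intro order_trans[OF _ padic_ord_shift_diff_funpow_dvd_ge[OF p]]) simp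
    moreover have "ereal (real b) \<le> padic_ord (of_int (int (p ^ b * (p - 1))) :: 'p padic)"
      using rat_ord_of_int_ge_iff[OF pr, of b "int (p ^ b * (p - 1))"]
      unfolding padic_ord_of_int p[symmetric] by simp
    ultimately show ?thesis using padic_ord_mult_ge by (metis add.commute of_nat_add)
  qed
  show ?thesis using n
  proof (induction a arbitrary: N)
    case (0 N)
    have "(shift_diff ^^ n) (\<lambda>k. of_int (gcd k (int (p ^ 0))) :: 'p padic) s = 0"
      using n0[OF 0] by (simp add: shift_diff_funpow_const)
    then show ?case using new[OF 0] unfolding split by simp
  next
    case (Suc a N)
    \<comment> \<open>One level down, the identity makes room for \<open>Suc N\<close> in place of
      \<open>N\<close>, which makes up for the smaller weight.\<close>
    have 1: "p ^ Suc a = p ^ a + p ^ a * (p - 1)"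
      using prime_ge_1_nat[OF pr] by (simp add: algebra_simps)
    have "p ^ a * (p - 1) \<le> p ^ Suc a * (p - 1)"
      using prime_ge_1_nat[OF pr] by (intro mult_right_mono power_increasing) auto
    then have "N * (p ^ a * (p - 1)) \<le> N * (p ^ Suc a * (p - 1))" by (rule mult_left_mono) simp
    then have "p ^ a + Suc N * (p ^ a * (p - 1)) \<le> n"
      unfolding mult_Suc using Suc.prems 1 by linarith
    from Suc.IH[OF this] have "ereal (real (N + Suc a))
      \<le> padic_ord ((shift_diff ^^ n) (\<lambda>k. of_int (gcd k (int (p ^ Suc a))) :: 'p padic) s)" by simp
    then show ?case unfolding split[of "Suc a"] using new[OF Suc.prems] by (rule padic_ord_add_ge)
  qed
qed

text \<open>The quotient \<open>k div q\<close> jumps between \<open>k\<close> and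
  \<open>k + 1\<close> exactly when \<open>q\<close> divides \<open>k + 1\<close>. The difference is
  thus again a \<open>q\<close>-periodic factor times a polynomial in
  \<open>k div q\<close>.\<close>

lemma shift_diff_poly_div:
  fixes f :: "'a::comm_ring_1 poly"
  assumes q: "q > 0"
  shows "shift_diff (\<lambda>k. poly f (of_int (k div int q))) =
    (\<lambda>k. of_bool (int q dvd k + 1) * poly (f - pcompose f [:1, 1:]) (of_int (k div int q)))"
proof
  fix k :: int
  define d m where "d = k div int q" and "m = k mod int q"
  have k: "k = int q * d + m" by (simp add: d_def m_def)
  have m: "0 \<le> m" "m < int q" using q by (simp_all add: m_def)
  show "shift_diff (\<lambda>k. poly f (of_int (k div int q))) k =
    of_bool (int q dvd k + 1) * poly (f - pcompose f [:1, 1:]) (of_int (k div int q))"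
  proof (cases "m + 1 = int q")
    case True
    then have eq: "k + 1 = int q * (d + 1)" using k by (simp add: algebra_simps)
    then have "(k + 1) div int q = d + 1" "int q dvd k + 1" using q by simp_all
    then show ?thesis by (simp add: shift_diff_def poly_pcompose add.commute flip: d_def)
  next
    case False
    then have "(k + 1) div int q = d" "(k + 1) mod int q = m + 1"
      using m k int_div_pos_eq[of "k + 1" "int q" d "m + 1"] int_mod_pos_eq[of "k + 1" "int q" d "m + 1"]
      by auto
    moreover from this have "\<not> int q dvd k + 1" using m by (simp add: dvd_eq_mod_eq_0)
    ultimately show ?thesis by (simp add: shift_diff_def flip: d_def)
  qed
qed

text \<open>Passes from the real quotient of the claim to division of natural numbers; truncating
  \<open>n - m\<close> at \<open>0\<close> can only enlarge the upper bound.\<close>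

lemma floor_diff_divide_le:
  assumes "y \<ge> real m"
  shows "\<lfloor>(real n - y) / real d\<rfloor> \<le> int ((n - m) div d)"
proof -
  have "(real n - y) / real d \<le> real (n - m) / real d"
    using assms by (intro divide_right_mono) auto
  then have "\<lfloor>(real n - y) / real d\<rfloor> \<le> \<lfloor>real (n - m) / real d\<rfloor>" by (rule floor_mono)
  then show ?thesis by (simp only: floor_divide_of_nat_eq)
qed

text \<open>In a Leibniz term with \<open>i > 0\<close>, one difference of the polynomial factor
  lowers the degree to \<open>l' = l - 1\<close>, and the other \<open>j = i - 1\<close> gain a
  power of \<open>p\<close>, on top of what the remaining \<open>n - i\<close> gain from the
  gcd.\<close>

lemma padic_ord_shift_diff_funpow_gcd_poly_ge:
  fixes f :: "'p::prime_card padic poly"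
  assumes p: "p = CARD('p)" and l: "degree f \<le> l"
    and f: "\<And>k::int. 0 \<le> padic_ord (poly f (of_int k))"
    and a: "a > 0" and n: "p ^ a \<le> n"
  shows "ereal (of_int (int ((n - p ^ a) div (p ^ a * (p - 1))) - (int l - 1) * int (Suc a) - 1))
    \<le> padic_ord ((shift_diff ^^ n) (\<lambda>k. of_int (gcd k (int (p ^ Suc a))) * poly f (of_int (k div int (p ^ Suc a)))) s)"
proof (rule padic_ord_shift_diff_funpow_mult_ge)
  fix i :: nat and s t :: int
  assume i: "i \<le> n"
  define N where "N m = (m - p ^ a) div (p ^ a * (p - 1))" for m
  let ?u = "\<lambda>k. of_int (gcd k (int (p ^ Suc a))) :: 'p padic"
  let ?v = "\<lambda>k. poly f (of_int (k div int (p ^ Suc a)))"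
  let ?B = "int (N n) - (int l - 1) * int (Suc a) - 1"
  have pr: "prime p" using p prime_card[where 'a = 'p] by simp
  have q: "p ^ Suc a > 0" using prime_gt_0_nat[OF pr] by simp
  have m: "p ^ a * (p - 1) > 0" using prime_gt_1_nat[OF pr] by simp
  have km: "p ^ a \<le> p ^ a * (p - 1)" using prime_gt_1_nat[OF pr] by simp
  have u: "ereal (real (N j + a)) \<le> padic_ord ((shift_diff ^^ j) ?u s)" if "p ^ a \<le> j" for j
  proof (rule padic_ord_shift_diff_funpow_gcd_ge[OF p])
    have "N j * (p ^ a * (p - 1)) \<le> j - p ^ a" unfolding N_def by simp
    then show "p ^ a + N j * (p ^ a * (p - 1)) \<le> j" using that by simp
  qed
  have u0: "0 \<le> padic_ord ((shift_diff ^^ j) ?u s)" for j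
    by (intro padic_ord_shift_diff_funpow_nonneg padic_ord_of_int_nonneg)
  have v0: "0 \<le> padic_ord ((shift_diff ^^ j) ?v t)" for j
    by (intro padic_ord_shift_diff_funpow_nonneg f)
  have "ereal (of_int ?B) \<le> padic_ord ((shift_diff ^^ (n - i)) ?u s * (shift_diff ^^ i) ?v t)"
  proof (cases i)
    case 0
    \<comment> \<open>The gcd alone gives \<open>N n + a\<close>, which is \<open>?B\<close> for
      \<open>l = 0\<close>, the largest value of \<open>?B\<close>.\<close>
    have "(int l - 1) * int (Suc a) \<ge> (- 1) * int (Suc a)" by (rule mult_right_mono) simp_all
    then have "?B \<le> int (N n + a)" by simp
    then have "ereal (of_int ?B) \<le> ereal (real (N n + a) + 0)"
      unfolding ereal_less_eq by linarith
    also have "\<dots> \<le> padic_ord ((shift_diff ^^ (n - i)) ?u s * (shift_diff ^^ i) ?v t)"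
      using u[OF n] v0[of i] 0 by (intro padic_ord_mult_ge) (simp_all flip: zero_ereal_def)
    finally show ?thesis .
  next
    case (Suc j)
    have Dv: "(shift_diff ^^ i) ?v = (shift_diff ^^ j) (shift_diff ?v)"
      by (simp add: Suc funpow_Suc_right del: funpow.simps)
    show ?thesis
    proof (cases l)
      case 0
      then obtain b where "f = [:b:]" using l by (metis le_zero_eq degree_eq_zeroE)
      then have "shift_diff ?v = (\<lambda>_. 0)" by (simp add: shift_diff_def fun_eq_iff)
      then show ?thesis unfolding Dv by (simp add: shift_diff_funpow_zero)
    next
      case (Suc l')
      let ?g = "f - pcompose f [:1, 1:]"
      have g: "degree ?g \<le> l'"
        using degree_forward_diff_le[of f l'] l Suc degree_minus[of ?g] by simp
      have per: "of_bool (int (p ^ Suc a) dvd k + int (p ^ Suc a) + 1) = (of_bool (int (p ^ Suc a) dvd k + 1) :: 'p padic)" for k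
        using dvd_add_triv_right_iff[of "int (p ^ Suc a)" "k + 1"] by (simp only: add.assoc add.commute)
      have "poly_act (([:0, 1:] ^ p ^ Suc a - 1) ^ (l' + 1)) (shift_diff ?v) = (\<lambda>_. 0)"
        unfolding shift_diff_poly_div[OF q]
        by (rule poly_act_periodic_mult_poly_div[where c = "\<lambda>k. of_bool (int (p ^ Suc a) dvd k + 1)", OF per q g])
      moreover have "0 \<le> padic_ord (shift_diff ?v k)" for k
        unfolding shift_diff_def by (intro padic_ord_diff_ge f)
      ultimately have v: "ereal (real ((j - (l' + 1) * p ^ a) div (p ^ a * (p - 1)) - l'))
          \<le> padic_ord ((shift_diff ^^ i) ?v t)"
        unfolding Dv by (intro padic_ord_shift_diff_funpow_ge[OF p])
      define A where "A = (n - i) div (p ^ a * (p - 1))"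
      define B where "B = (j - (l' + 1) * p ^ a) div (p ^ a * (p - 1))"
      \<comment> \<open>Replacing \<open>n - i - p ^ a\<close> by \<open>n - i\<close> in the
        numerator raises the quotient by at most one, as \<open>p ^ a \<le> p ^ a * (p - 1)\<close>.
        The contribution \<open>a \<ge> 1\<close> of the gcd covers this.\<close>
      have uA: "ereal (real A) \<le> padic_ord ((shift_diff ^^ (n - i)) ?u s)"
      proof (cases "p ^ a \<le> n - i")
        case True
        have "A \<le> (n - i - p ^ a + p ^ a * (p - 1)) div (p ^ a * (p - 1))"
          unfolding A_def using km True by (intro div_le_mono) linarith
        also have "\<dots> = N (n - i) + 1" unfolding N_def using m by (subst div_add_self2) simp_all
        also have "\<dots> \<le> N (n - i) + a" using a by simp
        finally have "ereal (real A) \<le> ereal (real (N (n - i) + a))" by simp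
        then show ?thesis using u[OF True] by (rule order_trans)
      next
        case False
        then have "A = 0" using km unfolding A_def by (intro div_less) linarith
        then show ?thesis using u0[of "n - i"] by (simp add: zero_ereal_def)
      qed
      \<comment> \<open>Add the two remainder estimates, with \<open>n = (n - i) + j + 1\<close>,
        and bound each of the \<open>l'\<close> extra copies of \<open>p ^ a\<close> by one
        divisor.\<close>
      have "N n \<le> A + B + l'+ 1"
      proof -
        have "n - i < Suc A * (p ^ a * (p - 1))" "j - (l' + 1) * p ^ a < Suc B * (p ^ a * (p - 1))"
          unfolding A_def B_def using m by (simp_all add: dividend_less_div_times)
        moreover have "l' * p ^ a \<le> l' * (p ^ a * (p - 1))" using km by (rule mult_left_mono) simp
        ultimately have "n - p ^ a < (A + B + l' + 2) * (p ^ a * (p - 1))"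
          using \<open>i = Suc j\<close> i by (simp add: algebra_simps)
        then have "N n < A + B + l' + 2" unfolding N_def using m by (simp add: div_less_iff_less_mult)
        then show ?thesis by simp
      qed
      \<comment> \<open>Since \<open>Suc a \<ge> 2\<close>, the term \<open>l' * Suc a\<close> pays
        twice for \<open>l'\<close>: once in the preceding estimate, once for the loss in
        \<open>B - l'\<close>.\<close>
      moreover have "int l' * 2 \<le> int l' * int (Suc a)" using a by (intro mult_left_mono) simp_all
      ultimately have "?B \<le> int (A + (B - l'))" using Suc by (simp add: of_nat_diff)
      then have "ereal (of_int ?B) \<le> ereal (real A + real (B - l'))"
        unfolding ereal_less_eq by linarith
      also have "\<dots> \<le> padic_ord ((shift_diff ^^ (n - i)) ?u s * (shift_diff ^^ i) ?v t)"
        using uA v unfolding B_def by (rule padic_ord_mult_ge)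
      finally show ?thesis .
    qed
  qed
  then show "ereal (of_int (int ((n - p ^ a) div (p ^ a * (p - 1))) - (int l - 1) * int (Suc a) - 1))
    \<le> padic_ord ((shift_diff ^^ (n - i)) ?u s * (shift_diff ^^ i) ?v t)" unfolding N_def .
qed

section \<open>The bound for \<open>\<alpha> = 0\<close>, \<open>\<alpha> = 1\<close> and
  \<open>\<alpha> \<ge> 2\<close>\<close>

theorem corollary1p2:
  fixes f :: "'p::prime_card padic poly" and p l \<alpha> n :: nat and r :: int
  assumes "p = CARD('p)"
    and "f \<noteq> 0" and "degree f = l"
    and "\<forall>a::int. poly f (of_int a) \<in> padic_integers"
    and "real n \<ge> real p powi (int \<alpha> - 1)"
  shows "padic_ord (\<Sum>k=0..n. of_nat (n choose k) * (-1) ^ k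
             * of_int (gcd (int k - r) (int (p ^ \<alpha>)))
             * poly f (of_int \<lfloor>real_of_int (int k - r) / real (p ^ \<alpha>)\<rfloor>))
      \<ge> ereal (real_of_int
           (\<lfloor>(real n - real p powi (int \<alpha> - 1) - real l * (of_bool (\<alpha> = 0) + of_bool (\<alpha> = 1)))
               / real (totient (p ^ \<alpha>))\<rfloor>
            - (int l - 1) * int \<alpha> - 1))"
proof -
  define w where "w k = of_int (gcd k (int (p ^ \<alpha>))) * poly f (of_int (k div int (p ^ \<alpha>)))" for k
  have pr: "prime p" using assms(1) prime_card[where 'a = 'p] by simp
  have q: "p ^ \<alpha> > 0" using prime_gt_0_nat[OF pr] by simp
  have f: "0 \<le> padic_ord (poly f (of_int k))" for k :: int
    using assms(4) by (simp add: padic_integers_def)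
  have w0: "0 \<le> padic_ord (w k)" for k
    unfolding w_def by (intro padic_ord_nonneg_mult padic_ord_of_int_nonneg f)
  have Tw: "poly_act (([:0, 1:] ^ p ^ \<alpha> - 1) ^ (l + 1)) w = (\<lambda>_. 0)"
    unfolding w_def by (rule poly_act_periodic_mult_poly_div) (use q assms(3) in simp_all)
  have "\<lfloor>real_of_int k / real (p ^ \<alpha>)\<rfloor> = k div int (p ^ \<alpha>)" for k
    using floor_divide_of_int_eq[of k "int (p ^ \<alpha>)", where 'a = real] by simp
  then have sum: "(\<Sum>k=0..n. of_nat (n choose k) * (-1) ^ k
             * of_int (gcd (int k - r) (int (p ^ \<alpha>)))
             * poly f (of_int \<lfloor>real_of_int (int k - r) / real (p ^ \<alpha>)\<rfloor>)) = (shift_diff ^^ n) w (- r)"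
    unfolding shift_diff_funpow_eq_sum w_def by (simp only: mult.assoc add.commute[of "- r"] add_uminus_conv_diff)
  consider "\<alpha> = 0" | "\<alpha> = Suc 0" | a where "\<alpha> = Suc a" "a > 0"
    by (metis gr0I not0_implies_Suc)
  then show ?thesis
  proof cases
    case 1
    \<comment> \<open>Here \<open>T = X - 1\<close>, so \<open>(1 - X) ^ n\<close> is a multiple of
      \<open>T ^ (l + 1)\<close> once \<open>n > l\<close>, and the sum vanishes. For
      \<open>n \<le> l\<close> the claimed bound is negative and integrality suffices.\<close>
    show ?thesis
    proof (cases "l < n")
      case True
      have "(1 - [:0, 1:] :: int poly) ^ n = ((- 1) ^ n * ([:0, 1:] - 1) ^ (n - (l + 1))) * ([:0, 1:] - 1) ^ (l + 1)"
      proof -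
        have "(1 - [:0, 1:] :: int poly) ^ n = (- 1) ^ n * ([:0, 1:] - 1) ^ n"
          by (subst power_mult_distrib[symmetric]) simp
        then show ?thesis using True by (simp only: mult.assoc power_add[symmetric]) simp
      qed
      then have "(shift_diff ^^ n) w = (\<lambda>_. 0)"
        unfolding poly_act_one_minus_X_power[symmetric] using Tw 1 by (simp add: poly_act_mult[abs_def])
      then show ?thesis unfolding sum by simp
    next
      case False
      have "real p powi (int \<alpha> - 1) \<ge> 0" by simp
      then have "\<lfloor>(real n - real p powi (int \<alpha> - 1) - real l)\<rfloor> \<le> 0"
        using False by linarith
      then have "ereal (real_of_int
           (\<lfloor>(real n - real p powi (int \<alpha> - 1) - real l * (of_bool (\<alpha> = 0) + of_bool (\<alpha> = 1)))
               / real (totient (p ^ \<alpha>))\<rfloor> - (int l - 1) * int \<alpha> - 1)) \<le> 0"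
        using 1 by simp
      also have "0 \<le> padic_ord ((shift_diff ^^ n) w (- r))"
        by (rule padic_ord_shift_diff_funpow_nonneg[OF w0])
      finally show ?thesis unfolding sum .
    qed
  next
    case 2
    \<comment> \<open>The Kronecker delta puts \<open>l + 1\<close> into the numerator, matching
      \<open>(l + 1) * p ^ 0\<close>, and \<open>(l - 1) * \<alpha> + 1\<close> is the subtracted
      \<open>l\<close>.\<close>
    have tot: "totient (p ^ \<alpha>) = p - 1" using 2 totient_prime[OF pr] by simp
    have "\<lfloor>(real n - (1 + real l)) / real (p - 1)\<rfloor> \<le> int ((n - (l + 1)) div (p - 1))"
      by (rule floor_diff_divide_le) simp
    then have "ereal (real_of_int
           (\<lfloor>(real n - real p powi (int \<alpha> - 1) - real l * (of_bool (\<alpha> = 0) + of_bool (\<alpha> = 1)))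
               / real (totient (p ^ \<alpha>))\<rfloor> - (int l - 1) * int \<alpha> - 1)) \<le>
        ereal (real ((n - (l + 1) * p ^ 0) div (p ^ 0 * (p - 1)) - l))"
      unfolding tot using 2 by (simp add: diff_diff_eq)
    also have "\<dots> \<le> padic_ord ((shift_diff ^^ n) w (- r))"
      using padic_ord_shift_diff_funpow_ge[OF assms(1) w0, where a = 0 and l = l] Tw 2 by simp
    finally show ?thesis unfolding sum .
  next
    case (3 a)
    \<comment> \<open>Both deltas vanish, and with \<open>\<alpha> = Suc a\<close> the claim is the
      estimate that uses the gcd.\<close>
    have pw: "real p powi (int \<alpha> - 1) = real (p ^ a)" using 3 by simp
    have tot: "totient (p ^ \<alpha>) = p ^ a * (p - 1)" using 3 totient_prime_power_Suc[OF pr] by simp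
    have n: "p ^ a \<le> n" using assms(5) unfolding pw by linarith
    have "\<lfloor>(real n - real (p ^ a)) / real (p ^ a * (p - 1))\<rfloor> \<le> int ((n - p ^ a) div (p ^ a * (p - 1)))"
      by (rule floor_diff_divide_le) simp
    then have "ereal (real_of_int
           (\<lfloor>(real n - real p powi (int \<alpha> - 1) - real l * (of_bool (\<alpha> = 0) + of_bool (\<alpha> = 1)))
               / real (totient (p ^ \<alpha>))\<rfloor> - (int l - 1) * int \<alpha> - 1)) \<le>
        ereal (of_int (int ((n - p ^ a) div (p ^ a * (p - 1))) - (int l - 1) * int (Suc a) - 1))"
      unfolding pw tot using 3 by simp
    also have "\<dots> \<le> padic_ord ((shift_diff ^^ n) w (- r))"
      unfolding w_def 3(1)
      by (rule padic_ord_shift_diff_funpow_gcd_poly_ge[OF assms(1)]) (use assms(3) f 3 n in simp_all)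
    finally show ?thesis unfolding sum .
  qed
qed

end
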